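(* Fix $\eta\in(0,1)$ and $\varepsilon\in(0,1)$. There is a sequence $(\mathcal{A}_N)_{N\ge1}$ of algorithms, $\mathcal{A}_N$ an $N$-sample algorithm (depending only on $N,\eta,\varepsilon$), such that for any sequence $(\mu_N)_{N\ge1}$ of reservoir distributions satisfying \[ \alpha_N\equiv G_{\mu_N}^{-1}(1-\eta)\ge\frac{1+\varepsilon}{2}\quad\text{for all }N, \] letting $a_{i^*}$ be the output of $\mathcal{A}_N$ run on $\mu_N$, we have \[ \limsup_{N\to\infty}\frac{\big(-\log\mathbb{P}[p_{i^*}<G_{\mu_N}^{-1}(1-\eta)-\varepsilon]\big)\cdot\log^2N}{c_{\alpha_N,\alpha_N-\varepsilon}\,N}\ \ge\ 1 . \]
   Context: Infinite-armed Bernoulli bandit: a reservoir distribution $\mu$ is any Borel probability measure on $[0,1]$. There are countably many arms $a_1,a_2,\dots$ whose means $p_1,p_2,\dots$ are drawn i.i.d. from $\mu$ (unknown to the algorithm). Each time arm $a_i$ is sampled it returns a reward in $\{0,1\}$ distributed as Bernoulli$(p_i)$, independently of all other rewards given the means. An algorithm, at each step, chooses (based on previously observed rewards and possibly internal randomness) an arm to sample, and at the end outputs an arm index $i^*$. An $N$-sample algorithm takes exactly $N$ samples almost surely and then outputs $i^*$. $G_\mu(\tau)=\mu([0,\tau])$, $G_\mu^{-1}(p)=\inf\{\tau:G_\mu(\tau)\ge p\}$. For $a,b\in[0,1]$, $c_{a,b}=\frac{(\arccos(1-2a)-\arccos(1-2b))^2}{2}$. *)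

theory Defs
  imports "HOL-Probability.Probability"
begin

definition reservoir :: "real measure \<Rightarrow> bool" where
  "reservoir \<mu> \<longleftrightarrow> sets \<mu> = sets borel \<and> prob_space \<mu> \<and> measure \<mu> {0..1} = 1"

definition G :: "real measure \<Rightarrow> real \<Rightarrow> real" where
  "G \<mu> \<tau> = measure \<mu> {0..\<tau>}"

definition Ginv :: "real measure \<Rightarrow> real \<Rightarrow> real" where
  "Ginv \<mu> q = Inf {\<tau>. G \<mu> \<tau> \<ge> q}"

definition cab :: "real \<Rightarrow> real \<Rightarrow> real" where
  "cab a b = (arccos (1 - 2*a) - arccos (1 - 2*b))^2 / 2"

text \<open>An algorithm: internal randomness is a single uniform seed in [0,1]
  (equivalent to any countable family of independent uniforms). Given the seed and the
  history of (arm index, reward) pairs it chooses the next arm; at the end it outputs an arm.\<close>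
record alg =
  next_arm :: "real \<Rightarrow> (nat \<times> bool) list \<Rightarrow> nat"
  outp   :: "real \<Rightarrow> (nat \<times> bool) list \<Rightarrow> nat"

definition alg_measurable :: "alg \<Rightarrow> bool" where
  "alg_measurable A \<longleftrightarrow>
     (\<forall>h. (\<lambda>s. next_arm A s h) \<in> borel \<rightarrow>\<^sub>M count_space UNIV) \<and>
     (\<forall>h. (\<lambda>s. outp A s h) \<in> borel \<rightarrow>\<^sub>M count_space UNIV)"

text \<open>Rewards: the k-th pull of arm i yields reward 1 iff U i k < p i, with the U i k
  i.i.d. uniform on [0,1]; so it is Bernoulli(p i), independent of everything else given the means.\<close>
fun hist :: "alg \<Rightarrow> real \<Rightarrow> (nat \<Rightarrow> real) \<Rightarrow> (nat \<Rightarrow> nat \<Rightarrow> real) \<Rightarrow> nat \<Rightarrow> (nat \<times> bool) list" where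
  "hist A s p U 0 = []"
| "hist A s p U (Suc t) =
     (let h = hist A s p U t; i = next_arm A s h
      in h @ [(i, U i (length (filter (\<lambda>x. fst x = i) h)) < p i)])"

definition run_output :: "alg \<Rightarrow> nat \<Rightarrow> real \<Rightarrow> (nat \<Rightarrow> real) \<Rightarrow> (nat \<Rightarrow> nat \<Rightarrow> real) \<Rightarrow> nat" where
  "run_output A N s p U = outp A s (hist A s p U N)"

definition unif01 :: "real measure" where
  "unif01 = uniform_measure lborel {0..1}"

definition bandit_space :: "real measure \<Rightarrow> (real \<times> (nat \<Rightarrow> real) \<times> (nat \<Rightarrow> nat \<Rightarrow> real)) measure" where
  "bandit_space \<mu> = unif01 \<Otimes>\<^sub>M ((PiM UNIV (\<lambda>_. \<mu>)) \<Otimes>\<^sub>M (PiM UNIV (\<lambda>_. PiM UNIV (\<lambda>_. unif01))))"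

definition err_prob :: "alg \<Rightarrow> nat \<Rightarrow> real measure \<Rightarrow> real \<Rightarrow> real" where
  "err_prob A N \<mu> \<theta> = measure (bandit_space \<mu>) {(s, p, U). p (run_output A N s p U) < \<theta>}"

definition rate :: "alg \<Rightarrow> nat \<Rightarrow> real measure \<Rightarrow> real \<Rightarrow> real \<Rightarrow> ereal" where
  "rate A N \<mu> \<eta> \<epsilon> =
     (let \<alpha> = Ginv \<mu> (1 - \<eta>); P = err_prob A N \<mu> (\<alpha> - \<epsilon>)
      in if P = 0 then \<infinity>
         else ereal ((- ln P) * (ln (real N))^2 / (cab \<alpha> (\<alpha> - \<epsilon>) * real N)))"

end

theory Submission
  imports Defs "HOL-Real_Asymp.Real_Asymp"
begin

text \<open>
  Arms are examined one after another; an arm is dropped for good as soon as its empirical mean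
  after \<open>n\<close> samples falls below a threshold \<open>q n\<close>, and the arm in use after \<open>N\<close> samples is the
  output. In the variance-stabilising coordinate \<open>\<theta> = arccos (1 - 2 p)\<close> the threshold falls from
  \<open>\<theta>\<^sub>\<alpha>\<close> to \<open>\<theta>\<^sub>\<beta>\<close> linearly in \<open>ln n\<close>, with slope \<open>x = (\<theta>\<^sub>\<alpha> - \<theta>\<^sub>\<beta>) / ln N\<close>. Whatever the mean of an arm,
  staying above this curve and then crossing it at time \<open>n\<close> has probability about
  \<open>exp (- n x\<^sup>2 / 2) = exp (- c n / ln\<^sup>2 N)\<close>, and so has the survival of an arm worse than \<open>\<beta>\<close> for \<open>n\<close>
  samples. Every sample thus costs an exponent \<open>c / ln\<^sup>2 N\<close>, and \<open>N\<close> samples cost \<open>c N / ln\<^sup>2 N\<close>. Arms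
  dropped after a first short test are free but consume only \<open>o(N)\<close> samples. Since \<open>\<alpha>\<close> is unknown,
  consecutive blocks of arms use decreasing guesses for it; \<open>\<alpha> \<ge> (1 + \<epsilon>) / 2\<close> makes \<open>c\<close> monotone, so that
  too high a guess does no harm.
\<close>

section \<open>Deviation bounds for Bernoulli sequences\<close>

text \<open>Why this curve: in the angle a Bernoulli variable has unit variance to first order, so a
  drift that is off by \<open>v\<close> costs \<open>v^2 / 2\<close> per sample. To keep the running
  mean at \<open>\<theta> - x ln t\<close> up to time \<open>n\<close>, the drift must be
  \<open>\<theta> - x ln t - x\<close>. The cheapest mean for this is the average drift, and the
  cost is then \<open>x^2 / 2\<close> times the integral of \<open>(ln (n / t) - 1)^2\<close> over
  \<open>[0, n]\<close>, which is \<open>n\<close>. Hence no reservoir can supply arms that waste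
  samples more cheaply. The obstacle is adaptivity: the number of dropped arms and their durations
  are random, and a union bound over all schedules would lose a factor exponential in
  \<open>N\<close>. Exponential moments of the durations replace it. Each arm then contributes one
  factor, and this factor must be so close to 1 that the product over all arms in play is only
  \<open>exp (o (N / ln\<^sup>2 N))\<close>.\<close>

lemma nn_integral_PiM_prod:
  assumes "\<And>i. prob_space (M i)" and J: "finite J" "J \<subseteq> I"
    and f: "\<And>i. i \<in> J \<Longrightarrow> f i \<in> borel_measurable (M i)"
  shows "(\<integral>\<^sup>+x. (\<Prod>i\<in>J. f i (x i)) \<partial>PiM I M) = (\<Prod>i\<in>J. \<integral>\<^sup>+x. f i x \<partial>M i)"
proof -
  interpret product_prob_space M I
    using assms(1) by (simp add: product_prob_space_def product_sigma_finite_def prob_space_imp_sigma_finite product_prob_space_axioms_def)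
  have meas: "(\<lambda>x. \<Prod>i\<in>J. f i (x i)) \<in> borel_measurable (PiM J M)"
    by (intro borel_measurable_prod_ennreal measurable_compose[OF measurable_component_singleton _] f)
  have "(\<integral>\<^sup>+x. (\<Prod>i\<in>J. f i (x i)) \<partial>PiM I M) = (\<integral>\<^sup>+x. (\<Prod>i\<in>J. f i (restrict x J i)) \<partial>PiM I M)"
    by (intro nn_integral_cong prod.cong) auto
  also have "\<dots> = (\<integral>\<^sup>+x. (\<Prod>i\<in>J. f i (x i)) \<partial>distr (PiM I M) (PiM J M) (\<lambda>x. restrict x J))"
    using J by (subst nn_integral_distr) (auto intro!: meas measurable_restrict_subset)
  also have "\<dots> = (\<Prod>i\<in>J. \<integral>\<^sup>+x. f i x \<partial>M i)"
    using J f by (subst distr_PiM_restrict_finite) (auto intro!: product_nn_integral_prod)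
  finally show ?thesis .
qed

lemma prob_space_unif01: "prob_space unif01"
  unfolding unif01_def by (rule prob_space_uniform_measure) auto

lemma sets_unif01 [simp, measurable_cong]: "sets unif01 = sets borel"
  by (simp add: unif01_def)

lemma space_unif01 [simp]: "space unif01 = UNIV"
  by (simp add: unif01_def)

lemma emeasure_unif01_lessThan:
  assumes "0 \<le> p" "p \<le> 1"
  shows "emeasure unif01 {..<p} = ennreal p"
proof -
  have "{0..1} \<inter> {..<p} = {0..<p}" using assms by auto
  then show ?thesis using assms by (simp add: unif01_def divide_ennreal_def)
qed

abbreviation coins :: "(nat \<Rightarrow> real) measure" where
  "coins \<equiv> PiM UNIV (\<lambda>_. unif01)"

lemma prob_space_coins: "prob_space coins"
  by (intro prob_space_PiM prob_space_unif01)

lemma nn_integral_unif01_coin: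
  assumes "0 \<le> p" "p \<le> 1"
  shows "(\<integral>\<^sup>+u. ennreal (exp (w * (of_bool (u < p) - p))) \<partial>unif01)
    = ennreal (p * exp (w * (1 - p)) + (1 - p) * exp (- w * p))"
proof -
  interpret prob_space unif01 by (rule prob_space_unif01)
  have c: "emeasure unif01 {p..} = ennreal (1 - p)"
  proof -
    have "emeasure unif01 (space unif01 - {..<p}) = emeasure unif01 (space unif01) - emeasure unif01 {..<p}"
      by (rule emeasure_compl) auto
    moreover have "space unif01 - {..<p} = {p..}" by auto
    ultimately show ?thesis
      using assms by (simp add: emeasure_unif01_lessThan emeasure_space_1[simplified] flip: ennreal_1 ennreal_minus)
  qed
  have "(\<integral>\<^sup>+u. ennreal (exp (w * (of_bool (u < p) - p))) \<partial>unif01)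
      = (\<integral>\<^sup>+u. ennreal (exp (w * (1 - p))) * indicator {..<p} u + ennreal (exp (- w * p)) * indicator {p..} u \<partial>unif01)"
    by (intro nn_integral_cong) (auto simp: indicator_def)
  also have "\<dots> = ennreal (exp (w * (1 - p))) * ennreal p + ennreal (exp (- w * p)) * ennreal (1 - p)"
    using assms by (subst nn_integral_add) (auto simp: nn_integral_cmult_indicator c emeasure_unif01_lessThan)
  also have "\<dots> = ennreal (p * exp (w * (1 - p)) + (1 - p) * exp (- w * p))"
    using assms by (simp add: mult.commute flip: ennreal_mult'' ennreal_plus)
  finally show ?thesis .
qed

lemma exp_le_quadratic:
  fixes z w :: real
  assumes "\<bar>z\<bar> \<le> w"
  shows "exp z \<le> 1 + z + z\<^sup>2 / 2 * exp w"
proof -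
  obtain t where t: "\<bar>t\<bar> \<le> \<bar>z\<bar>" "exp z = (\<Sum>m<2. z ^ m / fact m) + exp t / fact 2 * z ^ 2"
    using Maclaurin_exp_le[of z 2] by blast
  have "exp t \<le> exp w" using t(1) assms by simp
  then have "exp t / 2 * z\<^sup>2 \<le> exp w / 2 * z\<^sup>2" by (intro mult_right_mono) auto
  then show ?thesis using t(2) by (simp add: numeral_2_eq_2 mult_ac)
qed

text \<open>The linear terms cancel because the variable is centred, and the quadratic ones average
  to the variance. Keeping \<open>p * (1 - p)\<close> where Hoeffding's lemma has
  \<open>1 / 4\<close> is what lets the arccos metric appear with its exact constant; the
  exponential correction tends to 1 for the tilts of order \<open>x\<close> in the sharp
  bounds.\<close>

lemma bernoulli_mgf_le:
  fixes p w :: real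
  assumes "0 \<le> p" "p \<le> 1"
  shows "p * exp (w * (1 - p)) + (1 - p) * exp (- w * p) \<le> exp (p * (1 - p) * (w\<^sup>2 * exp \<bar>w\<bar> / 2))"
proof -
  have le: "\<bar>w * (1 - p)\<bar> \<le> \<bar>w\<bar>" "\<bar>- w * p\<bar> \<le> \<bar>w\<bar>"
    using assms by (auto simp: abs_mult intro!: mult_left_le)
  have "p * exp (w * (1 - p)) + (1 - p) * exp (- w * p)
      \<le> p * (1 + w * (1 - p) + (w * (1 - p))\<^sup>2 / 2 * exp \<bar>w\<bar>) + (1 - p) * (1 + (- w * p) + (- w * p)\<^sup>2 / 2 * exp \<bar>w\<bar>)"
    using assms by (intro add_mono mult_left_mono exp_le_quadratic le) auto
  also have "\<dots> = 1 + p * (1 - p) * (w\<^sup>2 * exp \<bar>w\<bar> / 2)"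
    by (simp add: power2_eq_square field_simps)
  also have "\<dots> \<le> exp (p * (1 - p) * (w\<^sup>2 * exp \<bar>w\<bar> / 2))"
    by (rule exp_ge_add_one_self)
  finally show ?thesis .
qed

text \<open>An integral instead of a measure, so that monotonicity in \<open>E\<close> holds for
  every predicate without measurability side conditions.\<close>

definition bern_prob :: "real \<Rightarrow> ((nat \<Rightarrow> bool) \<Rightarrow> bool) \<Rightarrow> ennreal" where
  "bern_prob p E = (\<integral>\<^sup>+u. of_bool (E (\<lambda>k. u k < p)) \<partial>coins)"

lemma bern_prob_mono:
  "(\<And>X. E X \<Longrightarrow> E' X) \<Longrightarrow> bern_prob p E \<le> bern_prob p E'"
  unfolding bern_prob_def by (intro nn_integral_mono) auto

lemma bern_prob_le_1: "bern_prob p E \<le> 1"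
proof -
  interpret prob_space coins by (rule prob_space_coins)
  have "bern_prob p E \<le> (\<integral>\<^sup>+u. 1 \<partial>coins)"
    unfolding bern_prob_def by (intro nn_integral_mono) auto
  then show ?thesis by (simp add: emeasure_space_1)
qed

definition nwins :: "(nat \<Rightarrow> bool) \<Rightarrow> nat \<Rightarrow> real" where
  "nwins X n = (\<Sum>t<n. of_bool (X t))"

text \<open>Exponential Markov inequality with a separate weight for each sample, as
  \<open>tilt\<close> demands. \<open>V\<close> and \<open>W\<close> bound the variance and the
  weights, so that the exponent is free of \<open>p\<close>.\<close>

lemma bern_prob_le_chernoff:
  assumes p: "0 \<le> p" "p \<le> 1"
    and E: "\<And>X. E X \<Longrightarrow> (\<Sum>t<n. w t * (of_bool (X t) - p)) \<ge> c"
    and V: "p * (1 - p) \<le> V" and W: "\<And>t. t < n \<Longrightarrow> \<bar>w t\<bar> \<le> W"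
  shows "bern_prob p E \<le> ennreal (exp (- c + V * (exp W / 2) * (\<Sum>t<n. (w t)\<^sup>2)))"
proof -
  have "bern_prob p E \<le> (\<integral>\<^sup>+u. ennreal (exp (- c)) * (\<Prod>t<n. ennreal (exp (w t * (of_bool (u t < p) - p)))) \<partial>coins)"
    unfolding bern_prob_def
  proof (intro nn_integral_mono)
    fix u :: "nat \<Rightarrow> real"
    show "of_bool (E (\<lambda>k. u k < p)) \<le> ennreal (exp (- c)) * (\<Prod>t<n. ennreal (exp (w t * (of_bool (u t < p) - p))))"
    proof (cases "E (\<lambda>k. u k < p)")
      case True
      have "1 \<le> exp (- c + (\<Sum>t<n. w t * (of_bool (u t < p) - p)))"
        using E[OF True] by simp
      also have "\<dots> = exp (- c) * (\<Prod>t<n. exp (w t * (of_bool (u t < p) - p)))"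
        by (subst exp_add) (simp add: exp_sum)
      finally show ?thesis
        by (simp add: True prod_ennreal flip: ennreal_mult')
    qed simp
  qed
  also have "\<dots> = ennreal (exp (- c)) * (\<integral>\<^sup>+u. (\<Prod>t<n. ennreal (exp (w t * (of_bool (u t < p) - p)))) \<partial>coins)"
    by (intro nn_integral_cmult) measurable
  also have "\<dots> = ennreal (exp (- c)) * (\<Prod>t<n. ennreal (p * exp (w t * (1 - p)) + (1 - p) * exp (- w t * p)))"
    by (subst nn_integral_PiM_prod) (auto simp: prob_space_unif01 nn_integral_unif01_coin[OF p])
  also have "\<dots> \<le> ennreal (exp (- c)) * (\<Prod>t<n. ennreal (exp (V * (exp W / 2) * (w t)\<^sup>2)))"
  proof -
    have "p * exp (w t * (1 - p)) + (1 - p) * exp (- w t * p) \<le> exp (V * (exp W / 2) * (w t)\<^sup>2)"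
      if t: "t \<in> {..<n}" for t
    proof -
      have "p * (1 - p) * ((w t)\<^sup>2 * exp \<bar>w t\<bar> / 2) \<le> V * ((w t)\<^sup>2 * exp W / 2)"
      proof (rule mult_mono)
        have "exp \<bar>w t\<bar> \<le> exp W" using W t by simp
        then show "(w t)\<^sup>2 * exp \<bar>w t\<bar> / 2 \<le> (w t)\<^sup>2 * exp W / 2"
          by (intro divide_right_mono mult_left_mono) auto
        show "0 \<le> V" using p V by (auto intro: order_trans[OF _ V])
      qed (use V in auto)
      then show ?thesis
        by (intro order_trans[OF bernoulli_mgf_le[OF p]]) (simp add: mult_ac)
    qed
    then show ?thesis by (intro mult_left_mono prod_mono_ennreal ennreal_leI) auto
  qed
  also have "\<dots> = ennreal (exp (- c + V * (exp W / 2) * (\<Sum>t<n. (w t)\<^sup>2)))"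
    unfolding exp_add sum_distrib_left by (simp add: prod_ennreal exp_sum flip: ennreal_mult')
  finally show ?thesis .
qed

lemma sum_shifted_coins: "(\<Sum>t<n. \<mu> * (of_bool (X t) - p)) = \<mu> * (nwins X n - n * p)" for \<mu> p :: real
  by (simp add: nwins_def sum_subtractf flip: sum_distrib_left)

text \<open>Constant tilt \<open>d\<close> or \<open>-d\<close>. The exponent is not sharp: the
  bound serves gaps of a fixed size, which cost far more per sample than the
  \<open>x\<^sup>2 / 2\<close> of a crossing.\<close>

lemma bern_prob_deviation:
  assumes p: "0 \<le> p" "p \<le> 1" and d: "0 \<le> d" "d \<le> 1"
    and E: "(\<forall>X. E X \<longrightarrow> nwins X n \<ge> n * (p + d)) \<or> (\<forall>X. E X \<longrightarrow> nwins X n \<le> n * (p - d))"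
  shows "bern_prob p E \<le> ennreal (exp (- (n * d\<^sup>2 / 2)))"
proof -
  have pp: "p * (1 - p) \<le> 1 / 4"
    using zero_le_power2[of "p - 1/2"] by (simp add: power2_eq_square field_simps)
  have gen: "bern_prob p E \<le> ennreal (exp (- (n * d\<^sup>2 / 2)))"
    if s: "\<bar>s\<bar> = d" and E: "\<And>X. E X \<Longrightarrow> (\<Sum>t<n. s * (of_bool (X t) - p)) \<ge> n * d\<^sup>2" for s
  proof -
    have "bern_prob p E \<le> ennreal (exp (- (n * d\<^sup>2) + 1/4 * (exp d / 2) * (\<Sum>t<n. s\<^sup>2)))"
      using E s pp by (intro bern_prob_le_chernoff p) auto
    also have "- (n * d\<^sup>2) + 1/4 * (exp d / 2) * (\<Sum>t<n. s\<^sup>2) \<le> - (n * d\<^sup>2 / 2)"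
    proof -
      have "s\<^sup>2 = d\<^sup>2" using s by (metis power2_abs)
      moreover have "exp d \<le> 4" using d exp_le by (smt (verit) exp_le_cancel_iff)
      then have "n * d\<^sup>2 * exp d \<le> n * d\<^sup>2 * 4" by (intro mult_left_mono) auto
      ultimately show ?thesis by (simp add: mult_ac)
    qed
    finally show ?thesis by (simp add: ennreal_leI)
  qed
  show ?thesis
    using E
  proof
    assume *: "\<forall>X. E X \<longrightarrow> nwins X n \<ge> n * (p + d)"
    show ?thesis
    proof (intro gen[of d])
      fix X assume "E X"
      from mult_left_mono[OF *[rule_format, OF this], of d] d show "(\<Sum>t<n. d * (of_bool (X t) - p)) \<ge> n * d\<^sup>2"
        unfolding sum_shifted_coins by (simp add: algebra_simps power2_eq_square)
    qed (use d in auto)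
  next
    assume *: "\<forall>X. E X \<longrightarrow> nwins X n \<le> n * (p - d)"
    show ?thesis
    proof (intro gen[of "-d"])
      fix X assume "E X"
      from mult_left_mono[OF *[rule_format, OF this], of d] d show "(\<Sum>t<n. -d * (of_bool (X t) - p)) \<ge> n * d\<^sup>2"
        unfolding sum_shifted_coins by (simp add: algebra_simps power2_eq_square)
    qed (use d in auto)
  qed
qed

section \<open>Sequential testing of arms\<close>

definition pref :: "(nat \<Rightarrow> bool) \<Rightarrow> nat \<Rightarrow> bool list" where
  "pref X n = map X [0..<n]"

lemma pref_0 [simp]: "pref X 0 = []"
  and pref_Suc: "pref X (Suc n) = pref X n @ [X n]"
  by (simp_all add: pref_def)

definition survives :: "(bool list \<Rightarrow> bool) \<Rightarrow> nat \<Rightarrow> (nat \<Rightarrow> bool) \<Rightarrow> bool" where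
  "survives R n X \<longleftrightarrow> (\<forall>k\<in>{1..n}. \<not> R (pref X k))"

definition stops_at :: "(bool list \<Rightarrow> bool) \<Rightarrow> nat \<Rightarrow> (nat \<Rightarrow> bool) \<Rightarrow> bool" where
  "stops_at R n X \<longleftrightarrow> 0 < n \<and> R (pref X n) \<and> survives R (n - 1) X"

definition arm_rewards :: "nat \<Rightarrow> (nat \<times> bool) list \<Rightarrow> bool list" where
  "arm_rewards i h = map snd (filter (\<lambda>x. fst x = i) h)"

text \<open>An algorithm sees only the history, so the state is recovered from it: the arm pulled
  last and all its rewards. Arms are used in index order and never revisited.\<close>

definition current_arm :: "(nat \<Rightarrow> bool list \<Rightarrow> bool) \<Rightarrow> (nat \<times> bool) list \<Rightarrow> nat" where
  "current_arm R h = (if h = [] then 0 else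
     let i = fst (last h) in if R i (arm_rewards i h) then Suc i else i)"

definition sequential_alg :: "(nat \<Rightarrow> bool list \<Rightarrow> bool) \<Rightarrow> alg" where
  "sequential_alg R = \<lparr>next_arm = (\<lambda>_. current_arm R), outp = (\<lambda>_. current_arm R)\<rparr>"

lemma alg_measurable_sequential: "alg_measurable (sequential_alg R)"
  by (simp add: alg_measurable_def sequential_alg_def)

text \<open>The induction carries two further invariants: no arm beyond the current one has been
  pulled, and the recorded rewards of the current arm are the first \<open>n\<close> outcomes of its
  own sequence. So the next pull reads outcome \<open>n\<close>, and a fresh arm starts from an
  empty record.\<close>

lemma sequential_run:
  fixes R s p U t
  defines "h \<equiv> hist (sequential_alg R) s p U t" and "X \<equiv> \<lambda>i k. U i k < p i"
  obtains T n where "t = (\<Sum>i<current_arm R h. T i) + n"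
    and "\<And>i. i < current_arm R h \<Longrightarrow> stops_at (R i) (T i) (X i)"
    and "survives (R (current_arm R h)) n (X (current_arm R h))"
proof -
  have "\<exists>T n. t = (\<Sum>i<current_arm R h. T i) + n
     \<and> (\<forall>i<current_arm R h. stops_at (R i) (T i) (X i))
     \<and> survives (R (current_arm R h)) n (X (current_arm R h))
     \<and> (\<forall>x\<in>set h. fst x \<le> current_arm R h)
     \<and> arm_rewards (current_arm R h) h = pref (X (current_arm R h)) n"
    unfolding h_def
  proof (induction t)
    case 0
    have "survives (R 0) 0 (X 0)" by (simp add: survives_def)
    then show ?case
      by (intro exI[of _ "\<lambda>_. 0"] exI[of _ 0]) (simp add: current_arm_def arm_rewards_def)
  next
    case (Suc t)
    define g where "g = hist (sequential_alg R) s p U t"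
    define j where "j = current_arm R g"
    from Suc obtain T n where IH: "t = (\<Sum>i<j. T i) + n" "\<And>i. i < j \<Longrightarrow> stops_at (R i) (T i) (X i)"
      "survives (R j) n (X j)" "\<And>x. x \<in> set g \<Longrightarrow> fst x \<le> j" "arm_rewards j g = pref (X j) n"
      unfolding g_def[symmetric] j_def[symmetric] by blast
    have "length (filter (\<lambda>x. fst x = j) g) = n"
      using arg_cong[OF IH(5), of length] by (simp add: arm_rewards_def pref_def)
    then have hS: "hist (sequential_alg R) s p U (Suc t) = g @ [(j, X j n)]"
      by (simp add: Let_def X_def sequential_alg_def flip: j_def g_def[unfolded sequential_alg_def])
    have rew: "arm_rewards j (g @ [(j, X j n)]) = pref (X j) (Suc n)"
      using IH(5) by (simp add: arm_rewards_def pref_Suc)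
    show ?case
    proof (cases "R j (pref (X j) (Suc n))")
      case True
      then have c: "current_arm R (g @ [(j, X j n)]) = Suc j"
        by (simp add: current_arm_def rew)
      have "filter (\<lambda>x. fst x = Suc j) g = []"
        using IH(4) by (force simp: filter_empty_conv)
      then have "arm_rewards (Suc j) (g @ [(j, X j n)]) = pref (X (Suc j)) 0"
        by (simp add: arm_rewards_def)
      moreover have "stops_at (R i) ((T(j := Suc n)) i) (X i)" if "i < Suc j" for i
        using IH(2,3) that True by (auto simp: stops_at_def less_Suc_eq)
      moreover have "Suc t = (\<Sum>i<Suc j. (T(j := Suc n)) i) + 0"
        using IH(1) by simp
      moreover have "survives (R (Suc j)) 0 (X (Suc j))" by (simp add: survives_def)
      moreover have "\<forall>x\<in>set (g @ [(j, X j n)]). fst x \<le> Suc j" using IH(4) by fastforce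
      ultimately show ?thesis unfolding hS c by blast
    next
      case False
      then have c: "current_arm R (g @ [(j, X j n)]) = j"
        by (simp add: current_arm_def rew)
      have "survives (R j) (Suc n) (X j)"
        using IH(3) False by (auto simp: survives_def le_Suc_eq)
      moreover have "Suc t = (\<Sum>i<j. T i) + Suc n" using IH(1) by simp
      moreover have "\<forall>x\<in>set (g @ [(j, X j n)]). fst x \<le> j" using IH(4) by fastforce
      ultimately show ?thesis unfolding hS c using IH(2) rew by blast
    qed
  qed
  then show thesis using that by blast
qed

text \<open>Equal to \<open>exp (L * T)\<close> for the stopping time \<open>T\<close> of the arm,
  and to 0 if the arm is not dropped within \<open>N\<close> samples: at most one summand is
  nonzero.\<close>

definition stop_cost :: "nat \<Rightarrow> real \<Rightarrow> (bool list \<Rightarrow> bool) \<Rightarrow> (nat \<Rightarrow> bool) \<Rightarrow> ennreal" where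
  "stop_cost N L R X = (\<Sum>n\<in>{1..N}. ennreal (exp (L * n)) * of_bool (stops_at R n X))"

text \<open>The number of samples left for the last arm depends on all earlier arms; summing over
  its possible values gives a function of that arm alone. The value 0 occurs when the final sample
  drops the previous arm.\<close>

definition survival_cost :: "nat \<Rightarrow> real \<Rightarrow> (bool list \<Rightarrow> bool) \<Rightarrow> (nat \<Rightarrow> bool) \<Rightarrow> ennreal" where
  "survival_cost N L R X = (\<Sum>n\<le>N. ennreal (exp (L * n)) * of_bool (survives R n X))"

lemma stop_cost_ge:
  assumes "stops_at R n X" "n \<le> N"
  shows "ennreal (exp (L * n)) \<le> stop_cost N L R X"
proof -
  have "0 < n" using assms by (simp add: stops_at_def)
  then have "ennreal (exp (L * n)) * of_bool (stops_at R n X) \<le> stop_cost N L R X"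
    unfolding stop_cost_def using assms by (intro member_le_sum) auto
  then show ?thesis using assms by simp
qed

lemma survival_cost_ge:
  assumes "survives R n X" "n \<le> N"
  shows "ennreal (exp (L * n)) \<le> survival_cost N L R X"
proof -
  have "ennreal (exp (L * n)) * of_bool (survives R n X) \<le> survival_cost N L R X"
    unfolding survival_cost_def using assms by (intro member_le_sum) auto
  then show ?thesis using assms by simp
qed

text \<open>
  The run lengths of the dropped arms and of the current arm add up to \<open>N\<close>, so their exponential
  weights multiply to \<open>exp (L * N)\<close>; this turns the adaptive run into a product over independent arms.
\<close>

lemma error_le_cost:
  fixes R s p U N J \<theta> L
  defines "X \<equiv> \<lambda>i k. U i k < p i"
  assumes err: "p (run_output (sequential_alg R) N s p U) < \<theta>" and L: "0 \<le> L"
  shows "1 \<le> (\<Sum>j<J. ennreal (exp (- L * N)) * ((\<Prod>i<j. stop_cost N L (R i) (X i))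
      * (survival_cost N L (R j) (X j) * of_bool (p j < \<theta>)))) + (\<Prod>i<J. stop_cost N L (R i) (X i))"
    (is "1 \<le> (\<Sum>j<J. ?a j) + ?b")
proof -
  define j where "j = current_arm R (hist (sequential_alg R) s p U N)"
  have j: "p j < \<theta>" using err by (simp add: run_output_def j_def sequential_alg_def)
  obtain T n where T: "N = (\<Sum>i<j. T i) + n" "\<And>i. i < j \<Longrightarrow> stops_at (R i) (T i) (X i)"
    "survives (R j) n (X j)"
    using sequential_run[where t = N and R = R and s = s and p = p and U = U] unfolding X_def j_def by metis
  have TN: "T i \<le> N" if "i < j" for i
    using T(1) member_le_sum[of i "{..<j}" T] that by auto
  have stop: "ennreal (exp (L * T i)) \<le> stop_cost N L (R i) (X i)" if "i < j" for i
    using T(2) TN that by (intro stop_cost_ge) auto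
  show ?thesis
  proof (cases "j < J")
    case True
    have "1 = exp (- L * N) * ((\<Prod>i<j. exp (L * T i)) * exp (L * n))"
      by (simp add: T(1) exp_sum[symmetric] algebra_simps flip: exp_add sum_distrib_left)
    then have "1 = ennreal (exp (- L * N)) * ((\<Prod>i<j. ennreal (exp (L * T i))) * ennreal (exp (L * n)))"
      by (metis (no_types, lifting) ennreal_1 ennreal_mult' exp_ge_zero prod.cong prod_ennreal prod_nonneg)
    also have "\<dots> \<le> ?a j"
      using stop survival_cost_ge[OF T(3), of N L] T(1) j by (intro mult_mono prod_mono_ennreal) auto
    also have "\<dots> \<le> (\<Sum>j<J. ?a j)"
      using True by (intro member_le_sum) auto
    finally show ?thesis by (simp add: add_increasing2)
  next
    \<comment> \<open>Here the first \<open>J\<close> arms have all been dropped. Because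
      \<open>L\<close> is nonnegative each factor is at least 1, and the product alone pays for this
      event.\<close>
    case False
    have "1 \<le> stop_cost N L (R i) (X i)" if "i < J" for i
    proof -
      have "ennreal 1 \<le> ennreal (exp (L * T i))" using L by (intro ennreal_leI) auto
      also have "\<dots> \<le> stop_cost N L (R i) (X i)" using that False by (intro stop) auto
      finally show ?thesis by simp
    qed
    then have "1 \<le> ?b" by (intro prod_ge_1) auto
    then show ?thesis by (simp add: add_increasing)
  qed
qed

section \<open>Independence of the arms under the bandit measure\<close>

abbreviation coin_table :: "(nat \<Rightarrow> nat \<Rightarrow> real) measure" where
  "coin_table \<equiv> PiM UNIV (\<lambda>_. coins)"

definition mean_cost :: "real measure \<Rightarrow> (real \<Rightarrow> (nat \<Rightarrow> bool) \<Rightarrow> ennreal) \<Rightarrow> ennreal" where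
  "mean_cost \<mu> f = (\<integral>\<^sup>+p. \<integral>\<^sup>+u. f p (\<lambda>k. u k < p) \<partial>coins \<partial>\<mu>)"

text \<open>The seed integrates out, and the coins are integrated with the means held fixed. The
  product rule then applies twice, to the rows of the coin table and to the i.i.d. means.\<close>

lemma nn_integral_bandit_prod:
  assumes \<mu>: "prob_space \<mu>" "sets \<mu> = sets borel" and J: "finite J"
    and f [measurable]: "\<And>i. i \<in> J \<Longrightarrow> (\<lambda>(p, u). f i p (\<lambda>k. u k < p)) \<in> borel_measurable (\<mu> \<Otimes>\<^sub>M coins)"
  shows "(\<integral>\<^sup>+(s, p, U). (\<Prod>i\<in>J. f i (p i) (\<lambda>k. U i k < p i)) \<partial>bandit_space \<mu>) = (\<Prod>i\<in>J. mean_cost \<mu> (f i))"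
proof -
  interpret S: prob_space unif01 by (rule prob_space_unif01)
  interpret C: prob_space coins by (rule prob_space_coins)
  interpret T: prob_space coin_table by (intro prob_space_PiM prob_space_coins)
  interpret A: prob_space "PiM UNIV (\<lambda>_. \<mu>)" by (intro prob_space_PiM \<mu>)
  interpret AT: pair_prob_space "PiM UNIV (\<lambda>_. \<mu>)" coin_table ..
  have m1: "(\<lambda>x. f i (fst x i) (\<lambda>k. snd x i k < fst x i)) \<in> borel_measurable (PiM UNIV (\<lambda>_. \<mu>) \<Otimes>\<^sub>M coin_table)"
    if "i \<in> J" for i
  proof -
    have "(\<lambda>x. (fst x i, snd x i)) \<in> PiM UNIV (\<lambda>_. \<mu>) \<Otimes>\<^sub>M coin_table \<rightarrow>\<^sub>M \<mu> \<Otimes>\<^sub>M coins"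
      by measurable
    from measurable_compose[OF this f[OF that]] show ?thesis by simp
  qed
  have m2: "(\<lambda>x. \<Prod>i\<in>J. f i (fst x i) (\<lambda>k. snd x i k < fst x i)) \<in> borel_measurable (PiM UNIV (\<lambda>_. \<mu>) \<Otimes>\<^sub>M coin_table)"
    using m1 by (intro borel_measurable_prod_ennreal) auto
  have "(\<integral>\<^sup>+(s, p, U). (\<Prod>i\<in>J. f i (p i) (\<lambda>k. U i k < p i)) \<partial>bandit_space \<mu>)
      = (\<integral>\<^sup>+s. \<integral>\<^sup>+x. (\<Prod>i\<in>J. f i (fst x i) (\<lambda>k. snd x i k < fst x i)) \<partial>(PiM UNIV (\<lambda>_. \<mu>) \<Otimes>\<^sub>M coin_table) \<partial>unif01)"
    unfolding bandit_space_def case_prod_beta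
    using measurable_compose[OF measurable_snd m2] by (subst AT.P.nn_integral_fst[symmetric]) auto
  also have "\<dots> = (\<integral>\<^sup>+x. (\<Prod>i\<in>J. f i (fst x i) (\<lambda>k. snd x i k < fst x i)) \<partial>(PiM UNIV (\<lambda>_. \<mu>) \<Otimes>\<^sub>M coin_table))"
    using S.emeasure_space_1 by simp
  also have "\<dots> = (\<integral>\<^sup>+p. \<integral>\<^sup>+U. (\<Prod>i\<in>J. f i (p i) (\<lambda>k. U i k < p i)) \<partial>coin_table \<partial>PiM UNIV (\<lambda>_. \<mu>))"
    by (subst T.nn_integral_fst[OF m2, symmetric]) simp
  also have "\<dots> = (\<integral>\<^sup>+p. (\<Prod>i\<in>J. \<integral>\<^sup>+u. f i (p i) (\<lambda>k. u k < p i) \<partial>coins) \<partial>PiM UNIV (\<lambda>_. \<mu>))"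
  proof (intro nn_integral_cong nn_integral_PiM_prod prob_space_coins J)
    fix p :: "nat \<Rightarrow> real" and i assume i: "i \<in> J" and p: "p \<in> space (PiM UNIV (\<lambda>_. \<mu>))"
    have "p i \<in> space \<mu>" using p by (auto simp: space_PiM)
    then have "(\<lambda>u. (p i, u)) \<in> coins \<rightarrow>\<^sub>M \<mu> \<Otimes>\<^sub>M coins" by simp
    from measurable_compose[OF this f[OF i]]
    show "(\<lambda>u. f i (p i) (\<lambda>k. u k < p i)) \<in> borel_measurable coins" by simp
  qed auto
  also have "\<dots> = (\<Prod>i\<in>J. mean_cost \<mu> (f i))"
    unfolding mean_cost_def
  proof (intro nn_integral_PiM_prod \<mu> J)
    fix i assume "i \<in> J"
    from C.borel_measurable_nn_integral_fst[OF f[OF this]]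
    show "(\<lambda>p. \<integral>\<^sup>+u. f i p (\<lambda>k. u k < p) \<partial>coins) \<in> borel_measurable \<mu>" by simp
  qed auto
  finally show ?thesis .
qed

text \<open>Boolean lists form a countable type, so with the discrete structure every rule
  \<open>R\<close> composed with \<open>pref\<close> is measurable at once.\<close>

lemma measurable_pref:
  assumes "sets \<mu> = sets borel"
  shows "(\<lambda>(p, u). pref (\<lambda>k. u k < p) n) \<in> (\<mu> :: real measure) \<Otimes>\<^sub>M coins \<rightarrow>\<^sub>M count_space UNIV"
proof (induction n)
  case 0
  then show ?case by simp
next
  case (Suc n)
  note assms[measurable_cong] Suc[measurable]
  have b: "(\<lambda>x. snd x n < fst x) \<in> \<mu> \<Otimes>\<^sub>M coins \<rightarrow>\<^sub>M count_space UNIV" by measurable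
  have "(\<lambda>x. (\<lambda>l x. l @ [snd x n < fst x]) (pref (\<lambda>k. snd x k < fst x) n) x) \<in> \<mu> \<Otimes>\<^sub>M coins \<rightarrow>\<^sub>M count_space UNIV"
  proof (rule measurable_compose_countable[where f = "\<lambda>l x. l @ [snd x n < fst x]"])
    fix l :: "bool list"
    show "(\<lambda>x. l @ [snd x n < fst x]) \<in> \<mu> \<Otimes>\<^sub>M coins \<rightarrow>\<^sub>M count_space UNIV"
      by (rule measurable_compose[OF b]) simp
  next
    show "(\<lambda>x. pref (\<lambda>k. snd x k < fst x) n) \<in> \<mu> \<Otimes>\<^sub>M coins \<rightarrow>\<^sub>M count_space UNIV"
      using Suc by (simp add: case_prod_beta)
  qed
  then show ?case by (simp add: pref_Suc case_prod_beta)
qed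

lemma measurable_pref_pred:
  assumes "sets \<mu> = sets borel"
  shows "Measurable.pred ((\<mu> :: real measure) \<Otimes>\<^sub>M coins) (\<lambda>x. R (pref (\<lambda>k. snd x k < fst x) n))"
  using measurable_compose[OF measurable_pref[OF assms, of n], of R "count_space UNIV"]
  by (simp add: case_prod_beta)

lemma measurable_survives:
  assumes "sets \<mu> = sets borel"
  shows "Measurable.pred ((\<mu> :: real measure) \<Otimes>\<^sub>M coins) (\<lambda>x. survives R n (\<lambda>k. snd x k < fst x))"
  unfolding survives_def using measurable_pref_pred[OF assms, measurable] by measurable

lemma measurable_stops_at:
  assumes "sets \<mu> = sets borel"
  shows "Measurable.pred ((\<mu> :: real measure) \<Otimes>\<^sub>M coins) (\<lambda>x. stops_at R n (\<lambda>k. snd x k < fst x))"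
  unfolding stops_at_def
  using measurable_pref_pred[OF assms, measurable] measurable_survives[OF assms, measurable] by measurable

lemma borel_measurable_stop_cost:
  assumes "sets \<mu> = sets borel"
  shows "(\<lambda>(p, u). stop_cost N L R (\<lambda>k. u k < p)) \<in> borel_measurable ((\<mu> :: real measure) \<Otimes>\<^sub>M coins)"
  unfolding stop_cost_def case_prod_beta of_bool_def
  using measurable_stops_at[OF assms, measurable] by measurable

lemma borel_measurable_survival_cost:
  assumes "sets \<mu> = sets borel"
  shows "(\<lambda>(p, u). survival_cost N L R (\<lambda>k. u k < p) * of_bool (p < \<theta>)) \<in> borel_measurable ((\<mu> :: real measure) \<Otimes>\<^sub>M coins)"
  unfolding survival_cost_def case_prod_beta of_bool_def
  using measurable_survives[OF assms, measurable] assms[measurable_cong] by measurable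

lemma mean_stop_cost:
  assumes "sets \<mu> = sets borel"
  shows "mean_cost \<mu> (\<lambda>_. stop_cost N L R)
    = (\<Sum>n\<in>{1..N}. ennreal (exp (L * n)) * (\<integral>\<^sup>+p. bern_prob p (stops_at R n) \<partial>\<mu>))"
proof -
  interpret C: prob_space coins by (rule prob_space_coins)
  have m: "(\<lambda>(p, u). of_bool (stops_at R n (\<lambda>k. u k < p)) :: ennreal) \<in> borel_measurable (\<mu> \<Otimes>\<^sub>M coins)" for n
    unfolding case_prod_beta of_bool_def using measurable_stops_at[OF assms, measurable] by measurable
  have m': "(\<lambda>u. of_bool (stops_at R n (\<lambda>k. u k < p)) :: ennreal) \<in> borel_measurable coins" for n p
  proof -
    have "(\<lambda>u. (p, u)) \<in> coins \<rightarrow>\<^sub>M \<mu> \<Otimes>\<^sub>M coins"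
      by (intro measurable_Pair1') (simp add: sets_eq_imp_space_eq[OF assms])
    from measurable_compose[OF this m] show ?thesis by simp
  qed
  have [measurable]: "(\<lambda>p. bern_prob p (stops_at R n)) \<in> borel_measurable \<mu>" for n
    using C.borel_measurable_nn_integral_fst[OF m] by (simp add: bern_prob_def)
  have "mean_cost \<mu> (\<lambda>_. stop_cost N L R)
      = (\<integral>\<^sup>+p. (\<Sum>n\<in>{1..N}. ennreal (exp (L * n)) * bern_prob p (stops_at R n)) \<partial>\<mu>)"
    unfolding mean_cost_def stop_cost_def bern_prob_def
    using m' by (intro nn_integral_cong) (simp add: nn_integral_sum nn_integral_cmult del: sum_mult_of_bool_eq)
  also have "\<dots> = (\<Sum>n\<in>{1..N}. ennreal (exp (L * n)) * (\<integral>\<^sup>+p. bern_prob p (stops_at R n) \<partial>\<mu>))"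
    by (simp add: nn_integral_sum nn_integral_cmult)
  finally show ?thesis .
qed

lemma mean_survival_cost:
  assumes "sets \<mu> = sets borel"
  shows "mean_cost \<mu> (\<lambda>p X. survival_cost N L R X * of_bool (p < \<theta>))
    = (\<Sum>n\<le>N. ennreal (exp (L * n)) * (\<integral>\<^sup>+p. bern_prob p (survives R n) * of_bool (p < \<theta>) \<partial>\<mu>))"
proof -
  interpret C: prob_space coins by (rule prob_space_coins)
  note assms[measurable_cong]
  have m: "(\<lambda>(p, u). of_bool (survives R n (\<lambda>k. u k < p)) :: ennreal) \<in> borel_measurable (\<mu> \<Otimes>\<^sub>M coins)" for n
    unfolding case_prod_beta of_bool_def using measurable_survives[OF assms, measurable] by measurable
  have m': "(\<lambda>u. of_bool (survives R n (\<lambda>k. u k < p)) :: ennreal) \<in> borel_measurable coins" for n p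
  proof -
    have "(\<lambda>u. (p, u)) \<in> coins \<rightarrow>\<^sub>M \<mu> \<Otimes>\<^sub>M coins"
      by (intro measurable_Pair1') (simp add: sets_eq_imp_space_eq[OF assms])
    from measurable_compose[OF this m] show ?thesis by simp
  qed
  have [measurable]: "(\<lambda>p. bern_prob p (survives R n)) \<in> borel_measurable \<mu>" for n
    using C.borel_measurable_nn_integral_fst[OF m] by (simp add: bern_prob_def)
  have [measurable]: "(\<lambda>p. of_bool (p < \<theta>) :: ennreal) \<in> borel_measurable \<mu>"
    unfolding of_bool_def by measurable
  have "mean_cost \<mu> (\<lambda>p X. survival_cost N L R X * of_bool (p < \<theta>))
      = (\<integral>\<^sup>+p. (\<Sum>n\<le>N. ennreal (exp (L * n)) * (bern_prob p (survives R n) * of_bool (p < \<theta>))) \<partial>\<mu>)"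
    unfolding mean_cost_def survival_cost_def bern_prob_def
    using m' by (intro nn_integral_cong)
      (simp add: nn_integral_sum nn_integral_cmult nn_integral_multc sum_distrib_right mult.assoc
        del: sum_mult_of_bool_eq)
  also have "\<dots> = (\<Sum>n\<le>N. ennreal (exp (L * n)) * (\<integral>\<^sup>+p. bern_prob p (survives R n) * of_bool (p < \<theta>) \<partial>\<mu>))"
    by (simp add: nn_integral_sum nn_integral_cmult)
  finally show ?thesis .
qed

text \<open>The pathwise bound is integrated and each product factors over the arms. The cutoff
  \<open>J\<close> is a free parameter that limits the number of factors; the last product pays for
  runs that go beyond \<open>J\<close> arms.\<close>

lemma err_prob_sequential_le:
  assumes \<mu>: "reservoir \<mu>" and L: "0 \<le> L"
  shows "ennreal (err_prob (sequential_alg R) N \<mu> \<theta>) \<le>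
    (\<Sum>j<J. ennreal (exp (- L * N)) * ((\<Prod>i<j. mean_cost \<mu> (\<lambda>_. stop_cost N L (R i)))
      * mean_cost \<mu> (\<lambda>p X. survival_cost N L (R j) X * of_bool (p < \<theta>))))
    + (\<Prod>i<J. mean_cost \<mu> (\<lambda>_. stop_cost N L (R i)))"
proof -
  have \<mu>': "prob_space \<mu>" "sets \<mu> = sets borel" using \<mu> by (auto simp: reservoir_def)
  interpret S: prob_space unif01 by (rule prob_space_unif01)
  interpret T: prob_space coin_table by (intro prob_space_PiM prob_space_coins)
  interpret A: prob_space "PiM UNIV (\<lambda>_. \<mu>)" by (intro prob_space_PiM \<mu>')
  interpret AT: pair_prob_space "PiM UNIV (\<lambda>_. \<mu>)" coin_table ..
  interpret B: pair_prob_space unif01 "PiM UNIV (\<lambda>_. \<mu>) \<Otimes>\<^sub>M coin_table" ..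
  have B: "emeasure (bandit_space \<mu>) A = ennreal (measure (bandit_space \<mu>) A)" for A
    unfolding bandit_space_def by (simp add: B.P.emeasure_eq_measure)
  \<comment> \<open>The product over \<open>{..j}\<close> under \<open>f j\<close> stands for a
    wrong output of arm \<open>j\<close>, the product over \<open>{..<J}\<close> under
    \<open>f J\<close> for the loss of all \<open>J\<close> arms.\<close>
  define f where "f j i = (if i < j then (\<lambda>_. stop_cost N L (R i))
    else (\<lambda>p X. survival_cost N L (R i) X * of_bool (p < \<theta>)))" for i j
  have fm: "(\<lambda>(p, u). f j i p (\<lambda>k. u k < p)) \<in> borel_measurable (\<mu> \<Otimes>\<^sub>M coins)" for i j
    using borel_measurable_stop_cost[OF \<mu>'(2)] borel_measurable_survival_cost[OF \<mu>'(2)] by (simp add: f_def)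
  define F where "F = (\<lambda>j (s :: real, p, U). \<Prod>i\<in>{..j}. f j i (p i) (\<lambda>k. U i k < p i))"
  define H where "H = (\<lambda>(s :: real, p, U). \<Prod>i\<in>{..<J}. f J i (p i) (\<lambda>k. U i k < p i))"
  have prodm: "(\<lambda>(s :: real, p, U). \<Prod>i\<in>I. f j i (p i) (\<lambda>k. U i k < p i)) \<in> borel_measurable (bandit_space \<mu>)"
    if "finite I" for I j
  proof -
    have "(\<lambda>x. f j i (fst (snd x) i) (\<lambda>k. snd (snd x) i k < fst (snd x) i)) \<in> borel_measurable (bandit_space \<mu>)" for i
    proof -
      have "(\<lambda>x. (fst (snd x) i, snd (snd x) i)) \<in> bandit_space \<mu> \<rightarrow>\<^sub>M \<mu> \<Otimes>\<^sub>M coins"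
        unfolding bandit_space_def by measurable
      from measurable_compose[OF this fm] show ?thesis by simp
    qed
    then show ?thesis unfolding case_prod_beta by (intro borel_measurable_prod_ennreal)
  qed
  have Fm: "F j \<in> borel_measurable (bandit_space \<mu>)" and Hm: "H \<in> borel_measurable (bandit_space \<mu>)" for j
    unfolding F_def H_def by (intro prodm; simp)+
  let ?E = "{(s, p, U). p (run_output (sequential_alg R) N s p U) < \<theta>}"
  have "ennreal (err_prob (sequential_alg R) N \<mu> \<theta>) = emeasure (bandit_space \<mu>) ?E"
    by (simp add: err_prob_def B)
  also have "\<dots> \<le> (\<integral>\<^sup>+x. (\<Sum>j<J. ennreal (exp (- L * N)) * F j x) + H x \<partial>bandit_space \<mu>)"
    \<comment> \<open>a non-measurable set has \<open>emeasure\<close> 0, so measurability of the error event is not needed\<close>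
  proof (cases "?E \<in> sets (bandit_space \<mu>)")
    case True
    have "emeasure (bandit_space \<mu>) ?E = (\<integral>\<^sup>+x. indicator ?E x \<partial>bandit_space \<mu>)"
      using True by simp
    also have "\<dots> \<le> (\<integral>\<^sup>+x. (\<Sum>j<J. ennreal (exp (- L * N)) * F j x) + H x \<partial>bandit_space \<mu>)"
    proof (intro nn_integral_mono)
      fix x :: "real \<times> (nat \<Rightarrow> real) \<times> (nat \<Rightarrow> nat \<Rightarrow> real)"
      obtain s p U where x: "x = (s, p, U)" by (cases x)
      have F: "F j x = (\<Prod>i<j. stop_cost N L (R i) (\<lambda>k. U i k < p i))
          * (survival_cost N L (R j) (\<lambda>k. U j k < p j) * of_bool (p j < \<theta>))" for j
        unfolding F_def x lessThan_Suc_atMost[symmetric] by (simp add: f_def)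
      have H: "H x = (\<Prod>i<J. stop_cost N L (R i) (\<lambda>k. U i k < p i))"
        unfolding H_def x by (simp add: f_def)
      show "indicator ?E x \<le> (\<Sum>j<J. ennreal (exp (- L * N)) * F j x) + H x"
        using error_le_cost[OF _ L, of p R N s U \<theta> J] unfolding F H by (auto simp: indicator_def x)
    qed
    finally show ?thesis .
  qed (simp add: emeasure_notin_sets)
  also have "\<dots> = (\<Sum>j<J. ennreal (exp (- L * N)) * integral\<^sup>N (bandit_space \<mu>) (F j)) + integral\<^sup>N (bandit_space \<mu>) H"
    using Fm Hm by (simp add: nn_integral_add nn_integral_sum nn_integral_cmult)
  also have "integral\<^sup>N (bandit_space \<mu>) H = (\<Prod>i<J. mean_cost \<mu> (\<lambda>_. stop_cost N L (R i)))"
    unfolding H_def by (subst nn_integral_bandit_prod[OF \<mu>' _ fm]) (simp_all add: f_def)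
  finally have bound: "ennreal (err_prob (sequential_alg R) N \<mu> \<theta>) \<le>
      (\<Sum>j<J. ennreal (exp (- L * N)) * integral\<^sup>N (bandit_space \<mu>) (F j))
      + (\<Prod>i<J. mean_cost \<mu> (\<lambda>_. stop_cost N L (R i)))" .
  have "integral\<^sup>N (bandit_space \<mu>) (F j) = (\<Prod>i<j. mean_cost \<mu> (\<lambda>_. stop_cost N L (R i)))
      * mean_cost \<mu> (\<lambda>p X. survival_cost N L (R j) X * of_bool (p < \<theta>))" for j
    unfolding F_def by (subst nn_integral_bandit_prod[OF \<mu>' _ fm]) (simp_all add: f_def flip: lessThan_Suc_atMost)
  with bound show ?thesis by simp
qed

section \<open>Crossing a logarithmic threshold\<close>

text \<open>A discrete \<open>ln (n / m)\<close>. The index runs from \<open>m\<close> to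
  \<open>n - 1\<close>, unlike in \<open>harm n - harm m\<close>, because \<open>1 / s\<close> is
  the weight of the partial sum \<open>S s\<close> in a sum of running means over
  \<open>{m..<n}\<close>.\<close>

definition hseg :: "nat \<Rightarrow> nat \<Rightarrow> real" where
  "hseg m n = (\<Sum>s\<in>{m..<n}. 1 / real s)"

lemma hseg_rec: "k < n \<Longrightarrow> hseg k n = 1 / real k + hseg (Suc k) n"
  by (simp add: hseg_def sum.atLeast_Suc_lessThan)

lemma hseg_nonneg: "0 \<le> hseg m n"
  by (simp add: hseg_def sum_nonneg)

lemma hseg_antimono: "m \<le> m' \<Longrightarrow> hseg m' n \<le> hseg m n"
  unfolding hseg_def by (intro sum_mono2) auto

lemma hseg_le:
  assumes "0 < m" "m \<le> n"
  shows "hseg m n \<le> (real n - real m) / real m"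
proof -
  have "hseg m n \<le> (\<Sum>s\<in>{m..<n}. 1 / real m)"
    unfolding hseg_def using assms by (intro sum_mono) (auto simp: frac_le)
  then show ?thesis using assms by (simp add: of_nat_diff)
qed

text \<open>
  The weights of the statistic \<open>\<Sum>s = m..<n. S s / s + S m - S n\<close>, a discrete form of the optimal tilt
  \<open>ln (n / t) - 1\<close>. They sum to 0, so the statistic is centred for every mean.
\<close>

definition tilt :: "nat \<Rightarrow> nat \<Rightarrow> nat \<Rightarrow> real" where
  "tilt m n t = (if t < m then hseg m n else hseg (Suc t) n - 1)"

lemma sum_tilt:
  assumes "m \<le> n"
  shows "(\<Sum>t<n. f (tilt m n t) t) = (\<Sum>t<m. f (hseg m n) t) + (\<Sum>t\<in>{m..<n}. f (hseg (Suc t) n - 1) t)"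
proof -
  have "(\<Sum>t<n. f (tilt m n t) t) = (\<Sum>t<m. f (tilt m n t) t) + (\<Sum>t\<in>{m..<n}. f (tilt m n t) t)"
    using sum.atLeastLessThan_concat[of 0 m n "\<lambda>t. f (tilt m n t) t"] assms by (simp add: atLeast0LessThan)
  also have "\<dots> = (\<Sum>t<m. f (hseg m n) t) + (\<Sum>t\<in>{m..<n}. f (hseg (Suc t) n - 1) t)"
    by (intro arg_cong2[where f = "(+)"] sum.cong) (auto simp: tilt_def)
  finally show ?thesis .
qed

text \<open>Summation by parts: \<open>Z t\<close> occurs in every partial sum of length
  \<open>s > t\<close>, which collects \<open>hseg (Suc t) n\<close>, or \<open>hseg m n\<close> for
  \<open>t < m\<close>. The boundary terms cancel for \<open>t < m\<close> and leave
  \<open>-1\<close> otherwise.\<close>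

lemma running_means_eq_tilt:
  fixes Z :: "nat \<Rightarrow> real"
  assumes "0 < m" "m \<le> n"
  shows "(\<Sum>s\<in>{m..<n}. sum Z {..<s} / s) + sum Z {..<m} - sum Z {..<n} = (\<Sum>t<n. tilt m n t * Z t)"
proof -
  have "(\<Sum>s\<in>{m..<n}. sum Z {..<s} / s) + sum Z {..<m} - sum Z {..<n}
      = hseg m n * sum Z {..<m} + (\<Sum>t\<in>{m..<n}. (hseg (Suc t) n - 1) * Z t)"
    using assms(2,1)
  proof (induction rule: inc_induct)
    case base
    then show ?case by (simp add: hseg_def)
  next
    case (step k)
    have "(b / r + A) + b - c = (1 / r + h) * b + ((h - 1) * z + B)"
      if "A + (b + z) - c = h * (b + z) + B" for A B b c h r z :: real
      using that by (simp add: ring_distribs)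
    from this[of _ "sum Z {..<k}" "Z k"] step show ?case
      by (simp only: sum.atLeast_Suc_lessThan[OF step(2)] hseg_rec[OF step(2)] sum.lessThan_Suc)
  qed
  then show ?thesis using sum_tilt[OF assms(2), of "\<lambda>w t. w * Z t"] by (simp add: sum_distrib_left)
qed

text \<open>Discrete form of the fact that the integral of \<open>(ln (n / t) - 1)^2\<close> over
  \<open>[0, n]\<close> is \<open>n\<close>.\<close>

lemma sum_tilt_squared:
  assumes "0 < m" "m \<le> n"
  shows "(\<Sum>t<n. (tilt m n t)\<^sup>2) = real n - real m + hseg m n"
proof -
  have "real m * (hseg m n)\<^sup>2 + (\<Sum>t\<in>{m..<n}. (hseg (Suc t) n - 1)\<^sup>2) = real n - real m + hseg m n"
    using assms(2,1)
  proof (induction rule: inc_induct)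
    case base
    then show ?case by (simp add: hseg_def)
  next
    case (step k)
    let ?h = "hseg (Suc k) n"
    have "real k * (1 / real k + ?h)\<^sup>2 + (?h - 1)\<^sup>2 = (real (Suc k) * ?h\<^sup>2) + 1 + 1 / real k"
      using step.prems by (simp add: power2_eq_square field_simps)
    with step show ?case
      by (simp add: sum.atLeast_Suc_lessThan hseg_rec[of k] algebra_simps)
  qed
  then show ?thesis using sum_tilt[OF assms(2), of "\<lambda>w t. w\<^sup>2"] by simp
qed

text \<open>The value of the tilted statistic along a threshold of unit slope in
  \<open>harm\<close>, a discrete form of the integral of \<open>ln (n / t)\<close>. Together with
  the squared norm of \<open>tilt\<close> it determines the exponent of a crossing.\<close>

lemma sum_harm_gaps:
  assumes "m \<le> n"
  shows "(\<Sum>s\<in>{m..<n}. harm n - harm s) + real m * (harm n - harm m) = real n - real m"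
  using assms
proof (induction rule: inc_induct)
  case base
  then show ?case by simp
next
  case (step k)
  have "(real k + 1) * inverse (1 + real k) = 1" by (simp add: field_simps)
  with step show ?case
    by (simp add: sum.atLeast_Suc_lessThan harm_Suc algebra_simps)
qed

text \<open>Chernoff bound with weights \<open>y / V * tilt m n t\<close>. On the event the
  statistic is at least \<open>y * (n - m)\<close>, and as it is centred for every mean,
  \<open>p\<close> enters only through the variance. \<open>n \<le> M * m\<close> bounds the
  weights, so for small \<open>y\<close> and large \<open>m\<close> the last factor is close to 1.
  The condition at \<open>m\<close> is listed separately for the case \<open>m = n\<close>, in which
  the range is empty.\<close>

lemma bern_prob_crossing:
  fixes q :: "nat \<Rightarrow> real"
  assumes p: "0 \<le> p" "p \<le> 1" and V: "p * (1 - p) \<le> V" "0 < V" and y: "0 \<le> y"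
    and mn: "0 < m" "m \<le> n" "real n \<le> M * real m" and M: "1 \<le> M"
    and q: "\<And>s. s \<in> {m..<n} \<Longrightarrow> q s - q n \<ge> y * (harm n - harm s)"
  shows "bern_prob p (\<lambda>X. (\<forall>s\<in>{m..<n}. nwins X s \<ge> s * q s) \<and> nwins X m \<ge> m * q m \<and> nwins X n < n * q n)
    \<le> ennreal (exp (- (y\<^sup>2 / (2 * V) * (real n - real m) * (2 - exp (y / V * M) * (1 + 1 / m)))))"
    (is "bern_prob p ?E \<le> _")
proof -
  have qm: "q m - q n \<ge> y * (harm n - harm m)"
    using q[of m] mn by (cases "m = n") auto
  have hM: "hseg m n \<le> M"
  proof -
    have "(real n - real m) / real m \<le> M" using mn by (simp add: divide_le_eq)
    then show ?thesis using hseg_le[OF mn(1,2)] by linarith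
  qed
  have W: "\<bar>y / V * tilt m n t\<bar> \<le> y / V * M" if "t < n" for t
  proof -
    have "hseg (Suc t) n \<le> hseg m n" if "\<not> t < m" using that by (intro hseg_antimono) auto
    then have "\<bar>tilt m n t\<bar> \<le> M"
      using hM M hseg_nonneg[of m n] hseg_nonneg[of "Suc t" n] by (auto simp: tilt_def)
    then show ?thesis using V y by (auto simp: abs_mult intro!: mult_left_mono divide_right_mono)
  qed
  have chernoff: "bern_prob p ?E \<le> ennreal (exp (- (y / V * (y * (real n - real m)))
      + V * (exp (y / V * M) / 2) * (\<Sum>t<n. (y / V * tilt m n t)\<^sup>2)))"
  proof (intro bern_prob_le_chernoff p V W)
    fix X assume X: "?E X"
    define Z where "Z = (\<lambda>t. of_bool (X t) - p)"
    have SZ: "sum Z {..<k} = nwins X k - k * p" for k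
      by (simp add: Z_def nwins_def sum_subtractf)
    have "y * (real n - real m)
        = (\<Sum>s\<in>{m..<n}. y * (harm n - harm s)) + real m * (y * (harm n - harm m))"
      by (subst sum_harm_gaps[OF mn(2), symmetric]) (simp only: distrib_left sum_distrib_left mult.left_commute[of y])
    also have "\<dots> \<le> (\<Sum>s\<in>{m..<n}. q s - q n) + real m * (q m - q n)"
      using q qm by (intro add_mono sum_mono mult_left_mono) auto
    \<comment> \<open>\<open>p\<close> can be inserted because its coefficients,
      \<open>n - m\<close> times 1, then \<open>m\<close> and \<open>- n\<close>, add up to
      0.\<close>
    also have "\<dots> = (\<Sum>s\<in>{m..<n}. q s - p) + real m * (q m - p) - real n * (q n - p)"
      using mn by (simp add: sum_subtractf algebra_simps)
    also have "\<dots> \<le> (\<Sum>s\<in>{m..<n}. sum Z {..<s} / s) + sum Z {..<m} - sum Z {..<n}"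
      using X mn by (intro diff_mono add_mono sum_mono) (auto simp: SZ field_simps)
    also have "\<dots> = (\<Sum>t<n. tilt m n t * Z t)"
      using mn by (intro running_means_eq_tilt)
    finally have "y / V * (y * (real n - real m)) \<le> y / V * (\<Sum>t<n. tilt m n t * Z t)"
      using V y by (intro mult_left_mono) auto
    then show "y / V * (y * (real n - real m)) \<le> (\<Sum>t<n. y / V * tilt m n t * (of_bool (X t) - p))"
      by (simp add: Z_def sum_distrib_left mult_ac)
  qed
  have "- (y / V * (y * (real n - real m))) + V * (exp (y / V * M) / 2) * (\<Sum>t<n. (y / V * tilt m n t)\<^sup>2)
      = - (y / V * (y * (real n - real m))) + y\<^sup>2 / (2 * V) * exp (y / V * M) * (real n - real m + hseg m n)"
  proof -
    have "(\<Sum>t<n. (y / V * tilt m n t)\<^sup>2) = (y / V)\<^sup>2 * (real n - real m + hseg m n)"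
      by (simp only: power_mult_distrib sum_distrib_left[symmetric] sum_tilt_squared[OF mn(1,2)])
    moreover have "V * (e / 2) * ((y / V)\<^sup>2 * L) = y\<^sup>2 / (2 * V) * e * L" if "0 < V" for V e L :: real
      using that by (simp add: power2_eq_square field_simps)
    ultimately show ?thesis using V(2) by presburger
  qed
  also have "\<dots> \<le> - (y / V * (y * (real n - real m)))
      + y\<^sup>2 / (2 * V) * exp (y / V * M) * (real n - real m + (real n - real m) / m)"
    using V(2) hseg_le[OF mn(1,2)] by (intro add_left_mono mult_left_mono) auto
  also have "\<dots> = - (y\<^sup>2 / (2 * V) * (real n - real m) * (2 - exp (y / V * M) * (1 + 1 / m)))"
  proof -
    have "- (y / V * (y * L)) + y\<^sup>2 / (2 * V) * e * (L + L / k) = - (y\<^sup>2 / (2 * V) * L * (2 - e * (1 + 1 / k)))"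
      if "0 < V" "0 < k" for V k L e :: real
      using that by (simp add: power2_eq_square field_simps)
    from this[OF V(2)] mn(1) show ?thesis by (simp only: of_nat_0_less_iff)
  qed
  finally show ?thesis
    by (intro order_trans[OF chernoff] ennreal_leI) (simp only: exp_le_cancel_iff)
qed

section \<open>The test of a single arm\<close>

definition ang :: "real \<Rightarrow> real" where
  "ang a = arccos (1 - 2 * a)"

definition quality :: "real \<Rightarrow> real" where
  "quality t = (1 - cos t) / 2"

lemma quality_ang: "0 \<le> a \<Longrightarrow> a \<le> 1 \<Longrightarrow> quality (ang a) = a"
  by (simp add: quality_def ang_def)

lemma ang_bounds: "0 \<le> a \<Longrightarrow> a \<le> 1 \<Longrightarrow> 0 \<le> ang a \<and> ang a \<le> pi"
  by (simp add: ang_def arccos_lbound arccos_ubound)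

lemma ang_mono: "0 \<le> a \<Longrightarrow> a \<le> b \<Longrightarrow> b \<le> 1 \<Longrightarrow> ang a \<le> ang b"
  unfolding ang_def by (rule arccos_le_arccos) auto

lemma quality_bounds: "0 \<le> quality t" "quality t \<le> 1"
  using cos_ge_minus_one[of t] by (simp_all add: quality_def)

lemma quality_mono: "0 \<le> s \<Longrightarrow> s \<le> t \<Longrightarrow> t \<le> pi \<Longrightarrow> quality s \<le> quality t"
  unfolding quality_def using cos_monotone_0_pi_le[of s t] by simp

text \<open>The right-hand side is also the square of the derivative of \<open>quality\<close>. This
  is variance stabilisation: an angular displacement \<open>v\<close> costs \<open>v^2 / 2\<close>
  per sample to leading order, wherever it happens.\<close>

lemma quality_variance: "quality t * (1 - quality t) = (sin t)\<^sup>2 / 4"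
proof -
  have "quality t * (1 - quality t) = (1 - (cos t)\<^sup>2) / 4"
    by (simp add: quality_def power2_eq_square field_simps)
  then show ?thesis by (simp add: sin_squared_eq)
qed

lemma DERIV_quality: "(quality has_real_derivative sin t / 2) (at t)"
  unfolding quality_def by (auto intro!: derivative_eq_intros)

lemma quality_Lipschitz:
  assumes "s \<le> t"
  shows "quality t - quality s \<le> (t - s) / 2"
proof (cases "s = t")
  case False
  then obtain z where z: "quality t - quality s = (t - s) * (sin z / 2)"
    using MVT2[of s t quality "\<lambda>z. sin z / 2"] DERIV_quality assms by auto
  show ?thesis unfolding z using assms mult_left_mono[of "sin z" 1 "t - s"] by simp
qed simp

lemma sin_diff_le: "s \<le> t \<Longrightarrow> sin s - sin t \<le> (t - s :: real)"
proof (cases "s = t")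
  assume "s \<le> t" "s \<noteq> t"
  then obtain z where z: "sin t - sin s = (t - s) * cos z"
    using MVT2[of s t sin cos] by auto
  show ?thesis using \<open>s \<le> t\<close> mult_left_mono[of "-1" "cos z" "t - s"] z by simp
qed simp

lemma quality_increment:
  assumes "0 \<le> u"
  shows "quality (t + u) - quality t \<ge> u * (sin t - u) / 2"
proof (cases "u = 0")
  case False
  then obtain z where z: "t < z" "z < t + u" "quality (t + u) - quality t = u * (sin z / 2)"
    using MVT2[of t "t + u" quality "\<lambda>z. sin z / 2"] DERIV_quality assms by auto
  have "sin t - u \<le> sin z" using sin_diff_le[of t z] z by simp
  then have "u * (sin t - u) \<le> u * sin z" using assms by (intro mult_left_mono)
  then show ?thesis by (simp add: z(3))
qed simp

text \<open>The derivative of the gap is the difference of \<open>1 / sqrt (z * (1 - z))\<close> at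
  \<open>z\<close> and at \<open>z - e\<close>. It is nonnegative when
  \<open>e * (2 * z - 1 - e)\<close> is, that is for \<open>z \<ge> (1 + e) / 2\<close>: the origin
  of the assumption on \<alpha>. Differentiating only inside the interval admits
  \<open>a' = 1\<close>, where \<open>arccos\<close> has no derivative.\<close>

lemma ang_gap_mono:
  assumes e: "0 < e" and a: "(1 + e) / 2 \<le> a" "a \<le> a'" "a' \<le> 1"
  shows "ang a - ang (a - e) \<le> ang a' - ang (a' - e)"
proof (cases "a = a'")
  case False
  define D where "D z = 1 / sqrt (z * (1 - z)) - 1 / sqrt ((z - e) * (1 - (z - e)))" for z
  have der: "((\<lambda>z. ang z - ang (z - e)) has_real_derivative D z) (at z)" if z: "a < z" "z < a'" for z
  proof -
    have pos: "0 < z * (1 - z)" "0 < (z - e) * (1 - (z - e))" using z a e by (auto intro!: mult_pos_pos)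
    have "sqrt (1 - (1 - 2 * z)\<^sup>2) = 2 * sqrt (z * (1 - z))" if "0 < z * (1 - z)" for z :: real
    proof -
      have "1 - (1 - 2 * z)\<^sup>2 = 4 * (z * (1 - z))" by (simp add: power2_eq_square algebra_simps)
      then show ?thesis by (simp add: real_sqrt_mult)
    qed
    note s = this[OF pos(1)] this[OF pos(2)]
    show ?thesis unfolding ang_def
      by (rule derivative_eq_intros refl | use z a e in \<open>simp; fail\<close>)+
         (use s pos in \<open>simp add: D_def field_simps\<close>)
  qed
  have D0: "0 \<le> D z" if z: "a < z" "z < a'" for z
  proof -
    have "0 < z * (1 - z)" using z a e by (auto intro!: mult_pos_pos)
    moreover have "0 \<le> e * (2 * z - 1 - e)" using z a e by (intro mult_nonneg_nonneg) auto
    then have "z * (1 - z) \<le> (z - e) * (1 - (z - e))" by (simp add: algebra_simps)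
    ultimately show ?thesis unfolding D_def by (auto intro!: divide_left_mono real_sqrt_le_mono mult_pos_pos)
  qed
  have cont: "continuous_on {a..a'} (\<lambda>z. ang z - ang (z - e))"
    unfolding ang_def using a e by (intro continuous_intros) auto
  show ?thesis
  proof (rule DERIV_nonneg_imp_increasing_open[OF a(2) _ cont])
    fix z assume "a < z" "z < a'"
    then show "\<exists>y. ((\<lambda>z. ang z - ang (z - e)) has_real_derivative y) (at z) \<and> 0 \<le> y"
      using der D0 by blast
  qed
qed simp

lemma ang_gap_ge:
  assumes "0 < e" "e \<le> a" "a \<le> 1"
  shows "2 * e \<le> ang a - ang (a - e)"
  using quality_Lipschitz[OF ang_mono[of "a - e" a]] assms by (simp add: quality_ang)

lemma harm_diff_le:
  assumes "0 < m" "m \<le> n" "real n \<le> M * real m"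
  shows "harm n - harm m \<le> (M :: real)"
proof -
  have "harm n - harm m \<le> (real n - real m) / real m"
    using assms(2)
  proof (induction rule: dec_induct)
    case (step k)
    have "inverse (real (Suc k)) \<le> 1 / real m"
      using step assms by (simp add: field_simps)
    with step show ?case by (simp add: harm_Suc add_divide_distrib diff_divide_distrib)
  qed simp
  also have "\<dots> \<le> M" using assms by (simp add: divide_le_eq)
  finally show ?thesis .
qed

section \<open>Stopping and survival probabilities of a single arm\<close>

definition wins :: "bool list \<Rightarrow> nat" where
  "wins r = length (filter id r)"

lemma wins_pref: "real (wins (pref X n)) = nwins X n"
  by (induction n) (auto simp: wins_def pref_Suc nwins_def)

text \<open>
  \<open>a\<close> is the initial threshold of the long test, \<open>t0\<close> the angle of the final one, \<open>x\<close> the slope, \<open>z\<close> the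
  relative loss allowed in the exponent. A first test after \<open>m0\<close> samples requires mean \<open>a + 2 d\<close>. Only
  the thresholds at times in \<open>{n / M..n}\<close> are exploited when bounding a crossing at time \<open>n\<close>.
\<close>

locale arm_test =
  fixes a t0 x d z s0 :: real and M m0 n0 N :: nat
  assumes d: "0 < d" "d \<le> 1" and z: "0 < z" "z < 1" and s0: "0 < s0"
    and M: "2 / z \<le> M" and m0: "0 < m0" "m0 < n0" and N: "n0 \<le> N"
    and x: "0 < x" "x * M \<le> z * s0" "exp (2 * x / s0 * M) * (1 + 1 / n0) \<le> 1 + z"
      "x\<^sup>2 * M \<le> (z * s0\<^sup>2 / 4)\<^sup>2"
    and a: "0 \<le> a" "a \<le> 1"
    and t0: "0 \<le> t0" "t0 + x * (1 + harm N) \<le> ang a"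
    and sin_ge: "\<And>t. t0 \<le> t \<Longrightarrow> t \<le> ang a \<Longrightarrow> s0 \<le> sin t"
begin

text \<open>The summand 1 keeps every threshold up to time \<open>N\<close> at least
  \<open>x\<close> above \<open>t0\<close>. This margin is what makes the survival of an arm
  slightly worse than \<open>quality t0\<close> as expensive as a crossing.\<close>

definition angle :: "nat \<Rightarrow> real" where
  "angle k = t0 + x * (1 + harm N - harm k)"

definition level :: "nat \<Rightarrow> real" where
  "level k = quality (angle k)"

definition rejects :: "bool list \<Rightarrow> bool" where
  "rejects r \<longleftrightarrow> (length r = m0 \<and> wins r < m0 * (a + 2 * d))
    \<or> (n0 \<le> length r \<and> length r \<le> N \<and> wins r < length r * level (length r))"

lemma M_ge: "2 \<le> real M" "1 \<le> M"
proof -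
  have "2 \<le> 2 / z" using z by (simp add: field_simps)
  then show "2 \<le> real M" using M by linarith
  then show "1 \<le> M" by simp
qed

lemma angle_bounds:
  assumes "k \<le> N"
  shows "t0 + x \<le> angle k" "angle k \<le> ang a" "angle k \<le> pi" "s0 \<le> sin (angle k)"
proof -
  have "harm k \<le> (harm N :: real)" using assms by (rule harm_mono)
  then have "x * 1 \<le> x * (1 + harm N - harm k)" using x by (intro mult_left_mono) auto
  then show 1: "t0 + x \<le> angle k" by (simp add: angle_def)
  have "x * (1 + harm N - harm k) \<le> x * (1 + harm N)"
    using x harm_nonneg[of k, where ?'a = real] by (intro mult_left_mono) auto
  then show 2: "angle k \<le> ang a" using t0 by (simp add: angle_def)
  then show "angle k \<le> pi" using ang_bounds[OF a] by simp
  show "s0 \<le> sin (angle k)" using 1 2 x by (intro sin_ge) auto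
qed

lemma level_le: "k \<le> N \<Longrightarrow> level k \<le> a"
  using quality_mono[of "angle k" "ang a"] angle_bounds[of k] t0 x ang_bounds[OF a] quality_ang[OF a]
  by (simp add: level_def)

lemma rejects_pref: "rejects (pref X n) \<longleftrightarrow> (n = m0 \<and> nwins X m0 < m0 * (a + 2 * d))
    \<or> (n0 \<le> n \<and> n \<le> N \<and> nwins X n < n * level n)"
proof -
  have "length (pref X n) = n" by (simp add: pref_def)
  then show ?thesis by (auto simp: rejects_def wins_pref)
qed

lemma survivesD:
  assumes "survives rejects n X"
  shows "m0 \<le> n \<Longrightarrow> nwins X m0 \<ge> m0 * (a + 2 * d)"
    and "n0 \<le> k \<Longrightarrow> k \<le> n \<Longrightarrow> k \<le> N \<Longrightarrow> nwins X k \<ge> k * level k"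
  using assms m0 unfolding survives_def rejects_pref by (force simp: not_less)+

lemma stops_at_m0:
  assumes p: "p \<le> 1" "a + 3 * d \<le> p"
  shows "bern_prob p (stops_at rejects m0) \<le> ennreal (exp (- (m0 * d\<^sup>2 / 2)))"
proof (intro bern_prob_deviation disjI2 allI impI)
  fix X assume "stops_at rejects m0 X"
  then have "nwins X m0 < m0 * (a + 2 * d)" using m0 by (auto simp: stops_at_def rejects_pref)
  moreover have "m0 * (a + 2 * d) \<le> m0 * (p - d)" using p by (intro mult_left_mono) auto
  ultimately show "nwins X m0 \<le> m0 * (p - d)" by linarith
qed (use p a d in auto)

text \<open>Split at \<open>a + d\<close>. A better arm must fall short of its mean by
  \<open>d\<close> at time \<open>n\<close>, as levels never exceed \<open>a\<close>; a worse one
  must have exceeded its mean by \<open>d\<close> in the first test. This serves the times up to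
  \<open>M * n0\<close>, too early for the crossing bound.\<close>

lemma stops_at_early:
  assumes p: "0 \<le> p" "p \<le> 1" and n: "n0 \<le> n"
  shows "bern_prob p (stops_at rejects n) \<le> ennreal (exp (- (m0 * d\<^sup>2 / 2)))"
proof (cases "a + d \<le> p")
  case True
  have "bern_prob p (stops_at rejects n) \<le> ennreal (exp (- (n * d\<^sup>2 / 2)))"
  proof (intro bern_prob_deviation p disjI2 allI impI)
    fix X assume "stops_at rejects n X"
    then have "nwins X n < n * level n" "n \<le> N" using m0 n by (auto simp: stops_at_def rejects_pref)
    moreover have "n * level n \<le> n * (p - d)"
      using level_le[OF \<open>n \<le> N\<close>] True by (intro mult_left_mono) auto
    ultimately show "nwins X n \<le> n * (p - d)" by linarith
  qed (use d in auto)
  also have "\<dots> \<le> ennreal (exp (- (m0 * d\<^sup>2 / 2)))"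
    using m0 n by (intro ennreal_leI) (auto intro!: mult_right_mono)
  finally show ?thesis .
next
  case False
  show ?thesis
  proof (intro bern_prob_deviation p disjI1 allI impI)
    fix X assume "stops_at rejects n X"
    then have "nwins X m0 \<ge> m0 * (a + 2 * d)"
      using survivesD(1)[of "n - 1" X] m0 n by (auto simp: stops_at_def)
    moreover have "m0 * (p + d) \<le> m0 * (a + 2 * d)"
      using False by (intro mult_left_mono) auto
    ultimately show "m0 * (p + d) \<le> nwins X m0" by linarith
  qed (use d in auto)
qed

lemma stops_at_other:
  assumes "n \<noteq> m0" "n < n0 \<or> N < n"
  shows "bern_prob p (stops_at rejects n) = 0"
proof -
  have "\<not> stops_at rejects n X" for X using assms by (auto simp: stops_at_def rejects_pref)
  then show ?thesis by (simp add: bern_prob_def)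
qed

text \<open>Moving \<open>p\<close> by some amount changes \<open>p * (1 - p)\<close> by at most
  that amount, and the window is a fraction \<open>z\<close> of the least possible variance
  \<open>s0\<^sup>2 / 4\<close>. Sharp exponents are needed only inside this window.\<close>

lemma variance_le:
  assumes t: "s0 \<le> sin t" and p: "\<bar>p - quality t\<bar> \<le> z * s0\<^sup>2 / 4" "0 \<le> p" "p \<le> 1"
  shows "p * (1 - p) \<le> (1 + z) * (sin t)\<^sup>2 / 4"
proof -
  let ?q = "quality t"
  have "p * (1 - p) - ?q * (1 - ?q) = (p - ?q) * (1 - p - ?q)" by (simp add: algebra_simps)
  also have "\<dots> \<le> \<bar>p - ?q\<bar> * \<bar>1 - p - ?q\<bar>" by (simp flip: abs_mult)
  also have "\<dots> \<le> \<bar>p - ?q\<bar> * 1" using p quality_bounds[of t] by (intro mult_left_mono) auto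
  also have "\<dots> \<le> z * s0\<^sup>2 / 4" using p by simp
  also have "\<dots> \<le> z * (sin t)\<^sup>2 / 4" using t s0 z by (intro divide_right_mono mult_left_mono power_mono) auto
  finally have "p * (1 - p) \<le> ?q * (1 - ?q) + z * (sin t)\<^sup>2 / 4" by linarith
  then show ?thesis by (simp only: quality_variance) (simp add: algebra_simps add_divide_distrib)
qed

text \<open>\<open>sin t\<close> cancels between the drop and the variance bound. Of the four
  factors \<open>1 - z\<close>, two come from the drop, one from
  \<open>1 / (1 + z) \<ge> 1 - z\<close> and one from \<open>u\<close>.\<close>

lemma rate_le:
  assumes t: "s0 \<le> sin t" and k: "0 \<le> k" and u: "1 - z \<le> u"
  shows "exp (- ((x * (1 - z) * sin t / 2)\<^sup>2 / (2 * ((1 + z) * (sin t)\<^sup>2 / 4)) * k * u))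
    \<le> exp (- (k * (x\<^sup>2 / 2 * (1 - z) ^ 4)))"
proof -
  have "(x * w * s / 2)\<^sup>2 / (2 * (v * s\<^sup>2 / 4)) = x\<^sup>2 / 2 * (w\<^sup>2 / v)" if "0 < s" "0 < v" for w s v
    using that by (simp add: power2_eq_square field_simps)
  then have "(x * (1 - z) * sin t / 2)\<^sup>2 / (2 * ((1 + z) * (sin t)\<^sup>2 / 4)) = x\<^sup>2 / 2 * ((1 - z)\<^sup>2 / (1 + z))"
    using t s0 z by auto
  moreover have "(1 - z) ^ 3 \<le> (1 - z)\<^sup>2 / (1 + z)"
  proof -
    have "(1 - z) * (1 + z) \<le> 1" using z by (simp add: algebra_simps)
    then have "(1 - z)\<^sup>2 * ((1 - z) * (1 + z)) \<le> (1 - z)\<^sup>2 * 1" by (intro mult_left_mono) auto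
    then show ?thesis using z by (simp add: pos_le_divide_eq power3_eq_cube power2_eq_square mult_ac)
  qed
  then have "x\<^sup>2 / 2 * (1 - z) ^ 3 * k * (1 - z) \<le> x\<^sup>2 / 2 * ((1 - z)\<^sup>2 / (1 + z)) * k * u"
    using k u z by (intro mult_mono mult_left_mono mult_nonneg_nonneg) auto
  ultimately show ?thesis by (simp add: power4_eq_xxxx power3_eq_cube mult_ac)
qed

lemma tilt_small:
  assumes t: "s0 \<le> sin t"
  shows "x * (1 - z) * sin t / 2 / ((1 + z) * (sin t)\<^sup>2 / 4) \<le> 2 * x / s0"
proof -
  have st: "0 < sin t" using t s0 by simp
  have eq: "x * w * s / 2 / (v * s\<^sup>2 / 4) = 2 * x / s * (w / v)" if "0 < s" "0 < v" for w s v
    using that by (simp add: power2_eq_square field_simps)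
  have "x * (1 - z) * sin t / 2 / ((1 + z) * (sin t)\<^sup>2 / 4) = 2 * x / sin t * ((1 - z) / (1 + z))"
    by (rule eq) (use st z in auto)
  also have "\<dots> \<le> 2 * x / s0 * 1"
    using st z x t s0 by (intro mult_mono divide_left_mono) auto
  finally show ?thesis by simp
qed

text \<open>For means near \<open>level n\<close> the crossing bound applies; means further away
  require a deviation of fixed size at time \<open>m\<close> or \<open>n\<close>. Four factors
  \<open>1 - z\<close> come from \<open>rate_le\<close>, the fifth from
  \<open>n - m \<ge> (1 - z) * n\<close>.\<close>

lemma stops_at_late:
  assumes p: "0 \<le> p" "p \<le> 1" and n: "M * n0 < n" "n \<le> N"
  shows "bern_prob p (stops_at rejects n) \<le> ennreal (exp (- (n * (x\<^sup>2 / 2 * (1 - z) ^ 5))))"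
proof -
  \<comment> \<open>\<open>m\<close> is \<open>n / M\<close> rounded up: large enough for
    \<open>n \<le> M * m\<close>, small enough to waste only a fraction \<open>z\<close> of the
    samples. \<open>n > M * n0\<close> puts \<open>m\<close> in the range where thresholds are in
    force.\<close>
  define m where "m = (n + M - 1) div M"
  have M0: "0 < M" using M_ge by simp
  have "M * m \<le> n + M - 1" unfolding m_def by (rule times_div_less_eq_dividend)
  moreover have "n + M - 1 < M + M * m" unfolding m_def using M0 by (rule dividend_less_times_div)
  ultimately have nm: "n \<le> M * m" "M * m \<le> n + M" by linarith+
  have "M * n0 < M * m" using n nm by linarith
  then have m0m: "n0 \<le> m" by simp
  have mpos: "0 < m" using m0m m0 by linarith
  have mreal: "real n \<le> M * real m" "M * real m \<le> n + M"
    using nm by (simp_all flip: of_nat_mult of_nat_add)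
  have "M * 1 \<le> M * n0" using m0 by (intro mult_le_mono2) simp
  then have Mn: "real M \<le> real n" using n by linarith
  have mlen: "real m \<le> z * n"
  proof -
    have "M * real m \<le> 2 * real n" using mreal Mn by linarith
    also have "\<dots> \<le> (z * M) * real n" using M z by (intro mult_right_mono) (auto simp: field_simps)
    finally have "M * real m \<le> M * (z * n)" by (simp add: mult_ac)
    then show ?thesis using M0 by simp
  qed
  have mn: "m \<le> n"
  proof -
    have "z * n \<le> n" using z by (simp add: mult_left_le_one_le)
    then show ?thesis using mlen by linarith
  qed
  let ?t = "angle n" let ?s = "sin (angle n)" let ?y = "x * (1 - z) * sin (angle n) / 2"
  have st: "s0 \<le> ?s" using angle_bounds n by auto
  have y0: "0 \<le> ?y" using st s0 x z by (auto intro!: mult_nonneg_nonneg)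
  \<comment> \<open>From \<open>m\<close> to \<open>n\<close> the angle falls by at most
    \<open>x * M \<le> z * s0\<close>, so the derivative of \<open>quality\<close> stays above
    \<open>1 - z\<close> times its value at \<open>angle n\<close>.\<close>
  have q: "?y * (harm n - harm s) \<le> level s - level n" if s: "s \<in> {m..<n}" for s
  proof -
    define u where "u = x * (harm n - harm s)"
    have h: "0 \<le> harm n - (harm s :: real)" using s harm_mono[of s n, where ?'a = real] by auto
    have "harm n - harm s \<le> harm n - (harm m :: real)" using s harm_mono[of m s, where ?'a = real] by auto
    also have "\<dots> \<le> M" using harm_diff_le[OF mpos mn mreal(1)] .
    finally have "u \<le> x * M" using x unfolding u_def by (intro mult_left_mono) auto
    then have u: "0 \<le> u" "u \<le> z * ?s"
    proof -
      show "0 \<le> u" using x h by (simp add: u_def)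
      have "z * s0 \<le> z * ?s" using z st by (intro mult_left_mono) auto
      then show "u \<le> z * ?s" using \<open>u \<le> x * M\<close> x(2) by linarith
    qed
    have "angle s = ?t + u" by (simp add: angle_def u_def algebra_simps)
    then have "level s - level n \<ge> u * (?s - u) / 2"
      using quality_increment[OF u(1), of ?t] by (simp add: level_def)
    moreover have "u * ((1 - z) * ?s) \<le> u * (?s - u)"
      using u by (intro mult_left_mono) (auto simp: algebra_simps)
    moreover have "?y * (harm n - harm s) = u * ((1 - z) * ?s) / 2" by (simp add: u_def)
    ultimately show ?thesis by linarith
  qed
  have EX: "(\<forall>s\<in>{m..<n}. nwins X s \<ge> s * level s) \<and> nwins X m \<ge> m * level m \<and> nwins X n < n * level n"
    if X: "stops_at rejects n X" for X
  proof -
    have "z * n < 1 * real n" using z M0 Mn by (intro mult_strict_right_mono) auto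
    then have "m < n" using mlen by linarith
    moreover have "survives rejects (n - 1) X" using X by (simp add: stops_at_def)
    moreover have "n \<noteq> m0" using \<open>m < n\<close> m0m m0 by linarith
    ultimately show ?thesis
      using survivesD(2)[of "n - 1" X] m0m n X by (auto simp: stops_at_def rejects_pref)
  qed
  \<comment> \<open>Even with only \<open>m \<ge> n / M\<close> samples, a deviation of fixed size
    costs at least as much as a crossing; this is the purpose of the assumption on
    \<open>x\<^sup>2 * M\<close>.\<close>
  have far: "exp (- (k * (z * s0\<^sup>2 / 4)\<^sup>2 / 2)) \<le> exp (- (n * (x\<^sup>2 / 2 * (1 - z) ^ 5)))" if k: "m \<le> k" for k :: nat
  proof -
    have "n * (x\<^sup>2 * (1 - z) ^ 5) \<le> (M * real m) * (x\<^sup>2 * 1)"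
      using z mreal by (intro mult_mono power_le_one mult_left_mono) auto
    also have "\<dots> = real m * (x\<^sup>2 * M)" by simp
    also have "\<dots> \<le> real k * (z * s0\<^sup>2 / 4)\<^sup>2" using x k by (intro mult_mono) auto
    finally show ?thesis by simp
  qed
  have d2: "0 \<le> z * s0\<^sup>2 / 4" "z * s0\<^sup>2 / 4 \<le> 1"
  proof -
    have "z * s0\<^sup>2 \<le> 1 * 1" using z st s0 by (intro mult_mono power_le_one) (auto intro: order_trans[OF st])
    then show "z * s0\<^sup>2 / 4 \<le> 1" by simp
  qed (use z in auto)
  have lev: "level n \<le> level m"
  proof (cases "m = n")
    case False
    have "0 \<le> ?y * (harm n - harm m)" using y0 harm_mono[OF mn, where ?'a = real] by (intro mult_nonneg_nonneg) auto
    then show ?thesis using q[of m] mn False by simp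
  qed simp
  consider "\<bar>p - level n\<bar> \<le> z * s0\<^sup>2 / 4" | "p + z * s0\<^sup>2 / 4 \<le> level n" | "level n \<le> p - z * s0\<^sup>2 / 4"
    by linarith
  then show ?thesis
  proof cases
    case 1
    let ?V = "(1 + z) * ?s\<^sup>2 / 4"
    have V: "p * (1 - p) \<le> ?V" using variance_le[OF st _ p] 1 by (simp add: level_def)
    have V0: "0 < ?V" using st s0 z by (auto intro!: mult_pos_pos)
    have "bern_prob p (stops_at rejects n)
      \<le> bern_prob p (\<lambda>X. (\<forall>s\<in>{m..<n}. nwins X s \<ge> s * level s) \<and> nwins X m \<ge> m * level m \<and> nwins X n < n * level n)"
      using EX by (intro bern_prob_mono) auto
    also have "\<dots> \<le> ennreal (exp (- (?y\<^sup>2 / (2 * ?V) * (real n - real m) * (2 - exp (?y / ?V * M) * (1 + 1 / m)))))"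
      using q M_ge mreal by (intro bern_prob_crossing p V V0 y0 mpos mn) auto
    also have "\<dots> \<le> ennreal (exp (- ((real n - real m) * (x\<^sup>2 / 2 * (1 - z) ^ 4))))"
    proof (intro ennreal_leI rate_le st)
      have "exp (?y / ?V * M) * (1 + 1 / m) \<le> exp (2 * x / s0 * M) * (1 + 1 / n0)"
      proof (rule mult_mono)
        show "exp (?y / ?V * M) \<le> exp (2 * x / s0 * M)"
          unfolding exp_le_cancel_iff using tilt_small[OF st] by (rule mult_right_mono) simp
        show "1 + 1 / real m \<le> 1 + 1 / real n0" using m0 m0m by (simp add: frac_le)
      qed auto
      then show "1 - z \<le> 2 - exp (?y / ?V * M) * (1 + 1 / m)" using x(3) by linarith
    qed (use mn in auto)
    also have "\<dots> \<le> ennreal (exp (- (n * (x\<^sup>2 / 2 * (1 - z) ^ 5))))"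
    proof -
      have "(1 - z) * n \<le> real n - real m" using mlen by (simp add: algebra_simps)
      then have "(1 - z) * n * (x\<^sup>2 / 2 * (1 - z) ^ 4) \<le> (real n - real m) * (x\<^sup>2 / 2 * (1 - z) ^ 4)"
        using z by (intro mult_right_mono) auto
      then show ?thesis by (intro ennreal_leI) (simp add: power_Suc[of _ 4, simplified] mult_ac eval_nat_numeral)
    qed
    finally show ?thesis .
  next
    case 2
    have "bern_prob p (stops_at rejects n) \<le> ennreal (exp (- (m * (z * s0\<^sup>2 / 4)\<^sup>2 / 2)))"
    proof (intro bern_prob_deviation p disjI1 allI impI d2)
      fix X assume "stops_at rejects n X"
      from EX[OF this] have "m * level m \<le> nwins X m" by simp
      moreover have "m * (p + z * s0\<^sup>2 / 4) \<le> m * level m" using 2 lev by (intro mult_left_mono) auto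
      ultimately show "m * (p + z * s0\<^sup>2 / 4) \<le> nwins X m" by linarith
    qed
    also have "\<dots> \<le> ennreal (exp (- (n * (x\<^sup>2 / 2 * (1 - z) ^ 5))))" by (intro ennreal_leI far) simp
    finally show ?thesis .
  next
    case 3
    have "bern_prob p (stops_at rejects n) \<le> ennreal (exp (- (n * (z * s0\<^sup>2 / 4)\<^sup>2 / 2)))"
    proof (intro bern_prob_deviation p disjI2 allI impI d2)
      fix X assume "stops_at rejects n X"
      from EX[OF this] have "nwins X n < n * level n" by simp
      moreover have "n * level n \<le> n * (p - z * s0\<^sup>2 / 4)" using 3 by (intro mult_left_mono) auto
      ultimately show "nwins X n \<le> n * (p - z * s0\<^sup>2 / 4)" by linarith
    qed
    also have "\<dots> \<le> ennreal (exp (- (n * (x\<^sup>2 / 2 * (1 - z) ^ 5))))" using mn by (intro ennreal_leI far)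
    finally show ?thesis .
  qed
qed

text \<open>The single time \<open>n\<close> and a constant tilt suffice: by the margin in
  \<open>angle\<close>, survival means exceeding the true mean by an angle of at least about
  \<open>x\<close>. Means far below \<open>quality t0\<close> fall under the crude deviation
  bound.\<close>

lemma survives_bad:
  assumes p: "0 \<le> p" "p \<le> 1" "p < quality t0" and n: "n0 \<le> n" "n \<le> N"
  shows "bern_prob p (survives rejects n) \<le> ennreal (exp (- (n * (x\<^sup>2 / 2 * (1 - z) ^ 5))))"
proof -
  let ?s = "sin t0" let ?y = "x * (1 - z) * sin t0 / 2"
  have st: "s0 \<le> ?s" using x t0 harm_nonneg[of N, where ?'a = real] by (intro sin_ge) (auto intro: order_trans[rotated])
  have xz: "x \<le> z * ?s"
  proof -
    have "x * 1 \<le> x * M" using x M_ge by (intro mult_left_mono) auto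
    also have "\<dots> \<le> z * ?s" using x(2) mult_left_mono[OF st, of z] z by linarith
    finally show ?thesis by simp
  qed
  have y0: "0 \<le> ?y" using st s0 x z by (auto intro!: mult_nonneg_nonneg)
  have "quality t0 + ?y \<le> quality (t0 + x)"
  proof -
    have "x * ((1 - z) * ?s) \<le> x * (?s - x)" using xz x by (intro mult_left_mono) (auto simp: algebra_simps)
    moreover have "x * (?s - x) / 2 \<le> quality (t0 + x) - quality t0" using quality_increment[of x t0] x by simp
    moreover have "?y = x * ((1 - z) * ?s) / 2" by simp
    ultimately show ?thesis by linarith
  qed
  also have "\<dots> \<le> level n"
    unfolding level_def using angle_bounds[OF n(2)] x t0 by (intro quality_mono) auto
  finally have lev: "quality t0 + ?y \<le> level n" .
  have EX: "nwins X n \<ge> n * level n" if "survives rejects n X" for X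
    using survivesD(2)[OF that, of n] n by simp
  show ?thesis
  proof (cases "p + z * s0\<^sup>2 / 4 \<le> quality t0")
    case True
    have "bern_prob p (survives rejects n) \<le> ennreal (exp (- (n * (z * s0\<^sup>2 / 4)\<^sup>2 / 2)))"
    proof (intro bern_prob_deviation p disjI1 allI impI)
      fix X assume "survives rejects n X"
      from EX[OF this] have "n * level n \<le> nwins X n" .
      moreover have "n * (p + z * s0\<^sup>2 / 4) \<le> n * level n" using lev True y0 by (intro mult_left_mono) auto
      ultimately show "n * (p + z * s0\<^sup>2 / 4) \<le> nwins X n" by linarith
    next
      have "z * s0\<^sup>2 \<le> 1 * 1" using z st s0 by (intro mult_mono power_le_one) (auto intro: order_trans[OF st])
      then show "z * s0\<^sup>2 / 4 \<le> 1" by simp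
    qed (use z in auto)
    also have "\<dots> \<le> ennreal (exp (- (n * (x\<^sup>2 / 2 * (1 - z) ^ 5))))"
    proof (intro ennreal_leI)
      have "x\<^sup>2 * (1 - z) ^ 5 \<le> x\<^sup>2 * M" using z M_ge by (intro mult_left_mono order_trans[OF power_le_one]) auto
      then have "x\<^sup>2 * (1 - z) ^ 5 \<le> (z * s0\<^sup>2 / 4)\<^sup>2" using x(4) by linarith
      then have "n * (x\<^sup>2 * (1 - z) ^ 5) \<le> n * (z * s0\<^sup>2 / 4)\<^sup>2" by (intro mult_left_mono) auto
      then show "exp (- (n * (z * s0\<^sup>2 / 4)\<^sup>2 / 2)) \<le> exp (- (n * (x\<^sup>2 / 2 * (1 - z) ^ 5)))" by simp
    qed
    finally show ?thesis .
  next
    case False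
    let ?V = "(1 + z) * ?s\<^sup>2 / 4"
    have V: "p * (1 - p) \<le> ?V" using variance_le[OF st _ p(1,2)] False p by simp
    have V0: "0 < ?V" using st s0 z by (auto intro!: mult_pos_pos)
    have "bern_prob p (survives rejects n)
      \<le> ennreal (exp (- (n * (?y\<^sup>2 / ?V)) + ?V * (exp (?y / ?V) / 2) * (\<Sum>t<n. (?y / ?V)\<^sup>2)))"
    proof (intro bern_prob_le_chernoff p V)
      fix X assume X: "survives rejects n X"
      have "n * ?y \<le> n * (level n - p)" using lev p by (intro mult_left_mono) auto
      also have "\<dots> \<le> nwins X n - n * p" using EX[OF X] by (simp add: algebra_simps)
      finally have "?y / ?V * (n * ?y) \<le> ?y / ?V * (nwins X n - n * p)"
        using divide_nonneg_pos[OF y0 V0] by (rule mult_left_mono)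
      then show "n * (?y\<^sup>2 / ?V) \<le> (\<Sum>t<n. ?y / ?V * (of_bool (X t) - p))"
        unfolding sum_shifted_coins by (simp only: power2_eq_square times_divide_eq_left times_divide_eq_right mult_ac)
    qed (use divide_nonneg_pos[OF y0 V0] in \<open>simp_all only: abs_of_nonneg order_refl\<close>)
    also have "- (n * (?y\<^sup>2 / ?V)) + ?V * (exp (?y / ?V) / 2) * (\<Sum>t<n. (?y / ?V)\<^sup>2)
        = - (?y\<^sup>2 / (2 * ?V) * n * (2 - exp (?y / ?V)))"
    proof -
      have "- (n * (y\<^sup>2 / V)) + V * (e / 2) * (\<Sum>t<n. (y / V)\<^sup>2) = - (y\<^sup>2 / (2 * V) * n * (2 - e))"
        if "0 < V" for y V e :: real
        using that by (simp add: power2_eq_square field_simps)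
      from this[OF V0] show ?thesis .
    qed
    also have "ennreal (exp \<dots>) \<le> ennreal (exp (- (n * (x\<^sup>2 / 2 * (1 - z) ^ 4))))"
    proof (intro ennreal_leI rate_le st)
      have "?y / ?V * 1 \<le> 2 * x / s0 * M" using tilt_small[OF st] M_ge x s0 y0 V0 by (intro mult_mono) auto
      then have "exp (?y / ?V) * 1 \<le> exp (2 * x / s0 * M) * (1 + 1 / n0)"
        by (intro mult_mono) auto
      then show "1 - z \<le> 2 - exp (?y / ?V)" using x(3) by linarith
    qed simp
    also have "\<dots> \<le> ennreal (exp (- (n * (x\<^sup>2 / 2 * (1 - z) ^ 5))))"
      using z by (intro ennreal_leI) (auto intro!: mult_left_mono power_decreasing)
    finally show ?thesis .
  qed
qed

end

section \<open>Averaging over the reservoir\<close>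

lemma reservoir_AE: "reservoir \<mu> \<Longrightarrow> AE p in \<mu>. 0 \<le> p \<and> p \<le> 1"
proof -
  assume r: "reservoir \<mu>"
  then interpret prob_space \<mu> by (simp add: reservoir_def)
  have "{0..1} \<in> events" using r by (simp add: reservoir_def)
  then have "AE p in \<mu>. p \<in> {0..1}" using prob_eq_1[of "{0..1}"] r by (simp add: reservoir_def)
  then show ?thesis by auto
qed

lemma reservoir_nn_integral_le:
  assumes "reservoir \<mu>" "\<And>p. 0 \<le> p \<Longrightarrow> p \<le> 1 \<Longrightarrow> f p \<le> c"
  shows "(\<integral>\<^sup>+p. f p \<partial>\<mu>) \<le> c"
proof -
  interpret prob_space \<mu> using assms by (simp add: reservoir_def)
  have "(\<integral>\<^sup>+p. f p \<partial>\<mu>) \<le> (\<integral>\<^sup>+p. c \<partial>\<mu>)"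
    using reservoir_AE[OF assms(1)] assms(2) by (intro nn_integral_mono_AE) auto
  then show ?thesis by (simp add: emeasure_space_1)
qed

text \<open>Below the infimum \<open>G\<close> does not reach \<open>1 - \<eta>\<close>; continuity
  from below along points increasing to the quantile extends this to the open half-line. So arms at
  or above the quantile have mass at least \<eta>.\<close>

lemma Ginv_facts:
  assumes r: "reservoir \<mu>" and e: "0 < \<eta>" "\<eta> < 1"
  shows "Ginv \<mu> (1 - \<eta>) \<le> 1" "emeasure \<mu> {..<Ginv \<mu> (1 - \<eta>)} \<le> ennreal (1 - \<eta>)"
proof -
  interpret prob_space \<mu> using r by (simp add: reservoir_def)
  have s: "sets \<mu> = sets borel" using r by (simp add: reservoir_def)
  let ?S = "{t. G \<mu> t \<ge> 1 - \<eta>}" let ?a = "Ginv \<mu> (1 - \<eta>)"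
  have "\<not> G \<mu> t \<ge> 1 - \<eta>" if "t < 0" for t using that e by (simp add: G_def)
  then have bdd: "bdd_below ?S" by (intro bdd_belowI[of _ 0]) (metis mem_Collect_eq not_less)
  have "1 \<in> ?S" using r e by (simp add: G_def reservoir_def)
  then show "?a \<le> 1" unfolding Ginv_def using bdd by (rule cInf_lower)
  have below: "prob {0..t} \<le> 1 - \<eta>" if "t < ?a" for t
  proof (rule ccontr)
    assume "\<not> prob {0..t} \<le> 1 - \<eta>"
    then have "t \<in> ?S" by (simp add: G_def)
    then have "?a \<le> t" unfolding Ginv_def using bdd by (rule cInf_lower)
    with that show False by simp
  qed
  let ?A = "\<lambda>n::nat. {0..?a - 1 / Suc n}"
  have "(\<lambda>n. prob (?A n)) \<longlonglongrightarrow> prob (\<Union>n. ?A n)"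
  proof (intro finite_Lim_measure_incseq)
    show "incseq ?A"
    proof (rule monoI)
      fix m n :: nat assume "m \<le> n"
      then have "1 / real (Suc n) \<le> 1 / real (Suc m)" by (intro frac_le) auto
      then have "?a - 1 / real (Suc m) \<le> ?a - 1 / real (Suc n)" by linarith
      then show "?A m \<subseteq> ?A n" by (simp only: atLeastatMost_subset_iff) simp
    qed
  qed (auto simp: s)
  also have "(\<Union>n. ?A n) = {0..<?a}"
  proof safe
    fix y assume y: "y \<in> {0..<?a}"
    then have "0 < ?a - y" by simp
    then obtain n where n: "1 / Suc n < ?a - y" by (rule nat_approx_posE)
    then have "y \<le> ?a - 1 / Suc n" by linarith
    then have "y \<in> ?A n" using y by simp
    then show "y \<in> (\<Union>n. ?A n)" by blast
  next
    fix y and n :: nat assume "y \<in> ?A n"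
    then have y: "0 \<le> y" "y \<le> ?a - 1 / real (Suc n)" by (simp_all only: atLeastAtMost_iff)
    have "0 < 1 / real (Suc n)" by simp
    then have "y < ?a" using y by linarith
    then show "y \<in> {0..<?a}" using y by simp
  qed
  finally have "(\<lambda>n. prob (?A n)) \<longlonglongrightarrow> prob {0..<?a}" .
  moreover have "\<exists>n0. \<forall>n\<ge>n0. prob (?A n) \<le> 1 - \<eta>" by (intro exI[of _ 0] allI impI below) simp
  ultimately have "prob {0..<?a} \<le> 1 - \<eta>" by (rule LIMSEQ_le_const2)
  moreover have "prob {..<?a} = prob {0..<?a}"
    using reservoir_AE[OF r] by (intro measure_eq_AE) (auto simp: s)
  ultimately show "emeasure \<mu> {..<?a} \<le> ennreal (1 - \<eta>)"
    by (simp add: emeasure_eq_measure ennreal_leI)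
qed

context arm_test
begin

lemma stop_integral_good:
  assumes r: "reservoir \<mu>" and e: "0 < \<eta>" "\<eta> < 1" and al: "a + 3 * d \<le> Ginv \<mu> (1 - \<eta>)"
  shows "(\<integral>\<^sup>+p. bern_prob p (stops_at rejects m0) \<partial>\<mu>) \<le> ennreal (1 - \<eta> + exp (- (m0 * d\<^sup>2 / 2)))"
proof -
  interpret prob_space \<mu> using r by (simp add: reservoir_def)
  have s: "sets \<mu> = sets borel" using r by (simp add: reservoir_def)
  let ?a = "Ginv \<mu> (1 - \<eta>)" let ?c = "ennreal (exp (- (m0 * d\<^sup>2 / 2)))"
  have bound: "bern_prob p (stops_at rejects m0) \<le> indicator {..<?a} p + ?c" if p: "0 \<le> p \<and> p \<le> 1" for p
  proof (cases "p < ?a")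
    case True
    then show ?thesis
      using add_mono[OF bern_prob_le_1[of p "stops_at rejects m0"] zero_le[of ?c]] by simp
  next
    case False
    then show ?thesis using stops_at_m0[of p] p al by simp
  qed
  have "AE p in \<mu>. bern_prob p (stops_at rejects m0) \<le> indicator {..<?a} p + ?c"
    using reservoir_AE[OF r] by eventually_elim (rule bound)
  then have "(\<integral>\<^sup>+p. bern_prob p (stops_at rejects m0) \<partial>\<mu>) \<le> (\<integral>\<^sup>+p. indicator {..<?a} p + ?c \<partial>\<mu>)"
    by (rule nn_integral_mono_AE)
  also have "\<dots> = emeasure \<mu> {..<?a} + ?c"
    by (subst nn_integral_add) (simp_all add: s emeasure_space_1 borel_measurable_indicator)
  also have "\<dots> \<le> ennreal (1 - \<eta>) + ?c" by (intro add_right_mono Ginv_facts r e)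
  also have "\<dots> = ennreal (1 - \<eta> + exp (- (m0 * d\<^sup>2 / 2)))" using e by (intro ennreal_plus[symmetric]) auto
  finally show ?thesis .
qed

text \<open>Three ranges of stopping times: \<open>m0\<close>; \<open>n0\<close> to
  \<open>M * n0\<close>, paid for by the first test; and later times, where the crossing bound beats
  \<open>exp (L * n)\<close> with a margin \<tau> per sample. Since \<open>n \<ge> n0\<close>, this
  margin can absorb the factor \<open>N\<close> from the number of times.\<close>

lemma mean_stop_cost_le:
  fixes L \<tau> \<nu> :: real
  assumes r: "reservoir \<mu>" and nu: "(\<integral>\<^sup>+p. bern_prob p (stops_at rejects m0) \<partial>\<mu>) \<le> ennreal \<nu>" "0 \<le> \<nu>"
    and L: "0 \<le> L" "L + \<tau> \<le> x\<^sup>2 / 2 * (1 - z) ^ 5" "0 \<le> \<tau>"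
  shows "mean_cost \<mu> (\<lambda>_. stop_cost N L rejects)
    \<le> ennreal (exp (L * m0) * \<nu> + N * (exp (L * (M * n0) - m0 * d\<^sup>2 / 2) + exp (- (\<tau> * n0))))"
proof -
  let ?B = "exp (L * (M * n0) - m0 * d\<^sup>2 / 2) + exp (- (\<tau> * n0))"
  let ?I = "\<lambda>n. \<integral>\<^sup>+p. bern_prob p (stops_at rejects n) \<partial>\<mu>"
  have M1: "1 \<le> real M" using M_ge by linarith
  have other: "ennreal (exp (L * n)) * ?I n \<le> ennreal ?B" if n: "n \<noteq> m0" for n
  proof (cases "n < n0 \<or> N < n")
    case True
    then show ?thesis using n by (simp add: stops_at_other)
  next
    case False
    show ?thesis
    proof (cases "n \<le> M * n0")
      case True
      have "?I n \<le> ennreal (exp (- (m0 * d\<^sup>2 / 2)))"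
        using False by (intro reservoir_nn_integral_le[OF r] stops_at_early) auto
      then have "ennreal (exp (L * n)) * ?I n \<le> ennreal (exp (L * (M * n0))) * ennreal (exp (- (m0 * d\<^sup>2 / 2)))"
      proof (intro mult_mono ennreal_leI)
        have "real n \<le> real M * real n0" using True by (simp flip: of_nat_mult)
        then show "exp (L * n) \<le> exp (L * (M * n0))" using L by (auto intro: mult_left_mono)
      qed auto
      also have "\<dots> = ennreal (exp (L * (M * n0) - m0 * d\<^sup>2 / 2))"
        by (simp flip: ennreal_mult' exp_add)
      also have "\<dots> \<le> ennreal ?B" by (intro ennreal_leI) simp
      finally show ?thesis .
    next
      case late: False
      have "?I n \<le> ennreal (exp (- (n * (x\<^sup>2 / 2 * (1 - z) ^ 5))))"
        using False late by (intro reservoir_nn_integral_le[OF r] stops_at_late) auto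
      then have "ennreal (exp (L * n)) * ?I n \<le> ennreal (exp (L * n)) * ennreal (exp (- (n * (x\<^sup>2 / 2 * (1 - z) ^ 5))))"
        by (intro mult_left_mono) auto
      also have "\<dots> = ennreal (exp (real n * (L - x\<^sup>2 / 2 * (1 - z) ^ 5)))"
        by (simp add: right_diff_distrib mult.commute flip: ennreal_mult' exp_add)
      also have "\<dots> \<le> ennreal (exp (- (\<tau> * n0)))"
      proof (intro ennreal_leI)
        have "real n * (L - x\<^sup>2 / 2 * (1 - z) ^ 5) \<le> n * (- \<tau>)" using L by (intro mult_left_mono) auto
        moreover have "\<tau> * n0 \<le> \<tau> * n" using False L by (intro mult_left_mono) auto
        ultimately show "exp (real n * (L - x\<^sup>2 / 2 * (1 - z) ^ 5)) \<le> exp (- (\<tau> * n0))" by (simp add: mult.commute)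
      qed
      also have "\<dots> \<le> ennreal ?B" by (intro ennreal_leI) simp
      finally show ?thesis .
    qed
  qed
  have "mean_cost \<mu> (\<lambda>_. stop_cost N L rejects) = (\<Sum>n\<in>{1..N}. ennreal (exp (L * n)) * ?I n)"
    using r by (intro mean_stop_cost) (simp add: reservoir_def)
  also have "\<dots> = ennreal (exp (L * m0)) * ?I m0 + (\<Sum>n\<in>{1..N} - {m0}. ennreal (exp (L * n)) * ?I n)"
    using m0 N by (intro sum.remove) auto
  also have "\<dots> \<le> ennreal (exp (L * m0)) * ennreal \<nu> + (\<Sum>n\<in>{1..N} - {m0}. ennreal ?B)"
    using nu other by (intro add_mono mult_left_mono sum_mono) auto
  also have "\<dots> \<le> ennreal (exp (L * m0)) * ennreal \<nu> + (\<Sum>n\<in>{1..N}. ennreal ?B)"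
    by (intro add_left_mono sum_mono2) auto
  also have "\<dots> = ennreal (exp (L * m0) * \<nu> + N * ?B)"
    using nu by (simp add: ennreal_of_nat_eq_real_of_nat add_nonneg_nonneg flip: ennreal_mult ennreal_mult' ennreal_plus)
  finally show ?thesis .
qed

lemma mean_survival_cost_le:
  fixes L :: real
  assumes r: "reservoir \<mu>" and th: "\<theta> \<le> quality t0"
    and L: "0 \<le> L" "L \<le> x\<^sup>2 / 2 * (1 - z) ^ 5"
  shows "mean_cost \<mu> (\<lambda>p X. survival_cost N L rejects X * of_bool (p < \<theta>))
    \<le> ennreal (n0 * exp (L * n0) + N + 1)"
proof -
  let ?I = "\<lambda>n. \<integral>\<^sup>+p. bern_prob p (survives rejects n) * of_bool (p < \<theta>) \<partial>\<mu>"
  have early: "ennreal (exp (L * n)) * ?I n \<le> ennreal (exp (L * n0))" if n: "n < n0" for n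
  proof -
    have "?I n \<le> 1"
      using bern_prob_le_1 by (intro reservoir_nn_integral_le[OF r]) (auto simp: of_bool_def)
    then have "ennreal (exp (L * n)) * ?I n \<le> ennreal (exp (L * n0)) * 1"
      using n L by (intro mult_mono ennreal_leI) (auto intro!: mult_left_mono)
    then show ?thesis by simp
  qed
  have late: "ennreal (exp (L * n)) * ?I n \<le> 1" if n: "n0 \<le> n" "n \<le> N" for n
  proof -
    have "?I n \<le> ennreal (exp (- (n * (x\<^sup>2 / 2 * (1 - z) ^ 5))))"
    proof (rule reservoir_nn_integral_le[OF r])
      fix p :: real assume "0 \<le> p" "p \<le> 1"
      then show "bern_prob p (survives rejects n) * of_bool (p < \<theta>) \<le> ennreal (exp (- (n * (x\<^sup>2 / 2 * (1 - z) ^ 5))))"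
        using survives_bad[of p n] n th by (cases "p < \<theta>") auto
    qed
    then have "ennreal (exp (L * n)) * ?I n \<le> ennreal (exp (L * n)) * ennreal (exp (- (n * (x\<^sup>2 / 2 * (1 - z) ^ 5))))"
      by (intro mult_left_mono) auto
    also have "\<dots> = ennreal (exp (real n * (L - x\<^sup>2 / 2 * (1 - z) ^ 5)))"
      by (simp add: right_diff_distrib mult.commute flip: ennreal_mult' exp_add)
    also have "\<dots> \<le> ennreal 1" using L by (intro ennreal_leI) (simp add: mult_nonneg_nonpos)
    finally show ?thesis by simp
  qed
  have "mean_cost \<mu> (\<lambda>p X. survival_cost N L rejects X * of_bool (p < \<theta>))
      = (\<Sum>n\<le>N. ennreal (exp (L * n)) * ?I n)"
    using r by (intro mean_survival_cost) (simp add: reservoir_def)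
  also have "\<dots> \<le> (\<Sum>n\<le>N. (if n < n0 then ennreal (exp (L * n0)) else 0) + 1)"
    using early late by (intro sum_mono) (auto simp: add_increasing2)
  also have "\<dots> = (\<Sum>n\<in>{..N} \<inter> {n. n < n0}. ennreal (exp (L * n0))) + (\<Sum>n\<le>N. 1)"
    by (simp add: sum.distrib sum.If_cases)
  also have "(\<Sum>n\<in>{..N} \<inter> {n. n < n0}. ennreal (exp (L * n0))) \<le> (\<Sum>n<n0. ennreal (exp (L * n0)))"
    by (intro sum_mono2) auto
  also have "(\<Sum>n<n0. ennreal (exp (L * n0))) + (\<Sum>n\<le>N. 1) = ennreal (n0 * exp (L * n0) + N + 1)"
    by (simp add: ennreal_of_nat_eq_real_of_nat add_ac flip: ennreal_mult' ennreal_plus ennreal_1)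
  finally show ?thesis by (simp add: add_right_mono)
qed

end

text \<open>An arbitrary arm multiplies the cost by at most \<open>exp B\<close>, with
  \<open>B\<close> small, even in blocks whose guess is so high that all arms may fail. The last
  \<open>K\<close> arms form a block with a suitable guess; each gains \<open>exp (- E)\<close>,
  which makes passing all \<open>J\<close> arms unlikely.\<close>

lemma err_prob_le:
  fixes L B S E :: real and J K :: nat
  assumes r: "reservoir \<mu>" and L: "0 \<le> L" and B: "0 \<le> B" and S: "0 \<le> S" and KJ: "K \<le> J"
    and stop: "\<And>i. i < J \<Longrightarrow> mean_cost \<mu> (\<lambda>_. stop_cost N L (R i)) \<le> ennreal (exp B)"
    and last: "\<And>i. i < J \<Longrightarrow> J - K \<le> i \<Longrightarrow> mean_cost \<mu> (\<lambda>_. stop_cost N L (R i)) \<le> ennreal (exp (- E))"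
    and surv: "\<And>i. i < J \<Longrightarrow> mean_cost \<mu> (\<lambda>p X. survival_cost N L (R i) X * of_bool (p < \<theta>)) \<le> ennreal S"
  shows "err_prob (sequential_alg R) N \<mu> \<theta> \<le> J * (exp (- L * N) * (exp (B * J) * S)) + exp (B * J - E * K)"
proof -
  let ?F = "\<lambda>i. mean_cost \<mu> (\<lambda>_. stop_cost N L (R i))"
  have prod: "(\<Prod>i<j. ?F i) \<le> ennreal (exp (B * j))" if "j \<le> J" for j
  proof -
    have "(\<Prod>i<j. ?F i) \<le> (\<Prod>i<j. ennreal (exp B))"
      using that stop by (intro prod_mono_ennreal) auto
    also have "\<dots> = ennreal (exp (B * j))" by (simp add: ennreal_power exp_of_nat2_mult mult.commute)
    finally show ?thesis .
  qed
  have "(\<Prod>i<J. ?F i) = (\<Prod>i<J - K. ?F i) * (\<Prod>i\<in>{J - K..<J}. ?F i)"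
    using prod.atLeastLessThan_concat[of 0 "J - K" J ?F] by (simp add: atLeast0LessThan)
  also have "\<dots> \<le> ennreal (exp (B * (J - K))) * (\<Prod>i\<in>{J - K..<J}. ennreal (exp (- E)))"
    using last by (intro mult_mono prod prod_mono_ennreal) auto
  also have "\<dots> = ennreal (exp (B * (J - K)) * exp (- (E * K)))"
    using KJ by (simp add: ennreal_power flip: ennreal_mult' exp_of_nat2_mult)
  also have "\<dots> \<le> ennreal (exp (B * J - E * K))"
    using B KJ by (intro ennreal_leI) (auto simp: of_nat_diff simp flip: exp_add intro!: mult_left_mono)
  finally have all: "(\<Prod>i<J. ?F i) \<le> ennreal (exp (B * J - E * K))" .
  have "ennreal (err_prob (sequential_alg R) N \<mu> \<theta>)
    \<le> (\<Sum>j<J. ennreal (exp (- L * N)) * ((\<Prod>i<j. ?F i)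
      * mean_cost \<mu> (\<lambda>p X. survival_cost N L (R j) X * of_bool (p < \<theta>)))) + (\<Prod>i<J. ?F i)"
    by (rule err_prob_sequential_le[OF r L])
  also have "\<dots> \<le> (\<Sum>j<J. ennreal (exp (- L * N)) * (ennreal (exp (B * J)) * ennreal S)) + ennreal (exp (B * J - E * K))"
  proof (intro add_mono sum_mono mult_left_mono mult_mono all surv)
    fix j assume j: "j \<in> {..<J}"
    have "(\<Prod>i<j. ?F i) \<le> ennreal (exp (B * j))" using j by (intro prod) auto
    also have "\<dots> \<le> ennreal (exp (B * J))" using j B by (intro ennreal_leI) (auto intro!: mult_left_mono)
    finally show "(\<Prod>i<j. ?F i) \<le> ennreal (exp (B * J))" .
  qed auto
  also have "\<dots> = ennreal (J * (exp (- L * N) * (exp (B * J) * S)) + exp (B * J - E * K))"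
    using S by (simp add: ennreal_of_nat_eq_real_of_nat flip: ennreal_mult ennreal_mult' ennreal_plus)
  finally show ?thesis using S by (subst (asm) ennreal_le_iff) (auto intro!: add_nonneg_nonneg)
qed

section \<open>Choice of parameters\<close>

lemma harm_le_ln: "0 < N \<Longrightarrow> harm N \<le> 1 + ln (real N)"
  using euler_mascheroni_sequence_decreasing[of 1 N] by (simp add: harm_expand)

text \<open>
  With \<open>l = ln N\<close>, the lengths must satisfy \<open>l \<ll> late_len / l\<^sup>2 \<ll> early_len\<close>, \<open>N / l\<^sup>2 \<ll> block_len\<close> and
  \<open>early_len * block_len \<ll> N\<close>.
\<close>

definition early_len :: "nat \<Rightarrow> nat" where "early_len N = nat \<lceil>ln N powr (3 / 2)\<rceil>"
definition late_len :: "nat \<Rightarrow> nat" where "late_len N = nat \<lceil>ln N powr (13 / 4)\<rceil>"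
definition block_len :: "nat \<Rightarrow> nat" where "block_len N = nat \<lceil>N / ln N powr (7 / 4)\<rceil>"

text \<open>Block \<open>g\<close> is meant for \<alpha> between \<open>1 - 3 * d * (g + 1)\<close>
  and \<open>1 - 3 * d * g\<close>. \<open>hi_level\<close> lies \<open>3 * d\<close> below the
  lower end, so that good arms pass the first test; \<open>lo_level\<close> lies \<epsilon> below
  the upper end, so that it is at least \<open>\<alpha> - \<epsilon>\<close>. The price is a gap
  shortened by \<open>6 * d\<close>.\<close>

definition hi_level :: "real \<Rightarrow> nat \<Rightarrow> real" where
  "hi_level d g = 1 - 3 * d * (g + 2)"
definition lo_level :: "real \<Rightarrow> real \<Rightarrow> nat \<Rightarrow> real" where
  "lo_level d \<epsilon> g = 1 - 3 * d * g - \<epsilon>"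
definition slope :: "real \<Rightarrow> real \<Rightarrow> nat \<Rightarrow> nat \<Rightarrow> real" where
  "slope d \<epsilon> N g = (ang (hi_level d g) - ang (lo_level d \<epsilon> g)) / (ln N + 2)"

definition block_rule :: "real \<Rightarrow> real \<Rightarrow> nat \<Rightarrow> nat \<Rightarrow> bool list \<Rightarrow> bool" where
  "block_rule d \<epsilon> N i = (let g = i div block_len N in
     arm_test.rejects (hi_level d g) (ang (lo_level d \<epsilon> g)) (slope d \<epsilon> N g) d (early_len N) (late_len N) N)"

text \<open>Bounds the logarithm of the cost factor of an arbitrary arm: a drop at the first test
  contributes \<open>exp (L * early_len N)\<close> with \<open>L \<le> 8 / (ln N)\<^sup>2\<close>,
  later drops \<open>1 / ln N\<close>. The 8 is \<open>4^2 / 2\<close>, as angles differ by at most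
  \<open>pi < 4\<close>.\<close>

definition overhead :: "nat \<Rightarrow> real" where
  "overhead N = 8 / (ln N)\<^sup>2 * early_len N + 1 / ln N"

text \<open>\<open>4 / (ln N + 2)\<close> is the largest possible slope; its conditions feed
  \<open>arm_test\<close>. The last four conditions say that late drops are negligible, that an arm
  of the last block costs less than 1, that prefactors and overhead fit into one slack factor
  \<open>1 - z\<close>, and that the last block outweighs the overhead and the largest exponent.
  \<open>1 / (3 * d) + 1\<close> bounds the number of blocks, \<open>2 * \<epsilon>\<^sup>2\<close>
  is a lower bound for \<open>cab\<close>, and \<open>ln 2\<close> splits the error into halves. The
  chosen powers of \<open>l = ln N\<close> give \<open>late_len / l^2\<close> of order
  \<open>l^(5/4)\<close>, between \<open>l\<close> and \<open>l^(3/2)\<close>, and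
  \<open>early_len * block_len / l^2\<close> of order \<open>N / l^(9/4)\<close>.\<close>

definition large_enough :: "real \<Rightarrow> real \<Rightarrow> real \<Rightarrow> real \<Rightarrow> real \<Rightarrow> nat \<Rightarrow> nat \<Rightarrow> bool" where
  "large_enough \<eta> \<epsilon> z d s0 M N \<longleftrightarrow>
     0 < early_len N \<and> early_len N < late_len N \<and> late_len N \<le> N \<and> 0 < block_len N \<and> 1 < ln N
     \<and> 4 / (ln N + 2) * M \<le> z * s0
     \<and> exp (2 * (4 / (ln N + 2)) / s0 * M) * (1 + 1 / late_len N) \<le> 1 + z
     \<and> (4 / (ln N + 2))\<^sup>2 * M \<le> (z * s0\<^sup>2 / 4)\<^sup>2
     \<and> (1 - z) * (ln N + 2) \<le> ln N
     \<and> N * (exp (8 / (ln N)\<^sup>2 * (M * late_len N) - real (early_len N) * d\<^sup>2 / 2)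
          + exp (- (z * (1 - z) ^ 9 * (2 * \<epsilon>\<^sup>2) / (ln N)\<^sup>2 * late_len N))) \<le> 1 / ln N
     \<and> exp (8 / (ln N)\<^sup>2 * early_len N) * (1 - \<eta> + exp (- (real (early_len N) * d\<^sup>2 / 2))) + 1 / ln N \<le> exp (- (\<eta> / 4))
     \<and> ln 2 + ln ((1 / (3 * d) + 1) * block_len N) + (1 / (3 * d) + 1) * block_len N * overhead N
          + ln (late_len N * exp (8 / (ln N)\<^sup>2 * late_len N) + N + 1)
        \<le> z * (1 - z) ^ 10 * (2 * \<epsilon>\<^sup>2) * (N / (ln N)\<^sup>2)
     \<and> 8 * (N / (ln N)\<^sup>2) \<le> \<eta> / 4 * block_len N - ln 2 - (1 / (3 * d) + 1) * block_len N * overhead N"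

lemma eventually_large_enough:
  fixes \<eta> \<epsilon> z d s0 :: real and M :: nat
  assumes "0 < \<eta>" "\<eta> < 1" "0 < \<epsilon>" "0 < z" "z < 1" "0 < d" "0 < s0" "0 < M"
  shows "eventually (large_enough \<eta> \<epsilon> z d s0 M) at_top"
proof -
  define C where "C = 1 / (3 * d) + 1"
  define D where "D = d\<^sup>2 / 2"
  define T where "T = z * (1 - z) ^ 9 * (2 * \<epsilon>\<^sup>2)"
  have C: "0 < C" and D: "0 < D" and T: "0 < T" and T': "0 < z * (1 - z) ^ 10 * (2 * \<epsilon>\<^sup>2)"
    and M: "0 < 8 * real M" and M': "0 < real M" and zs: "0 < z * s0" "0 < (z * s0\<^sup>2 / 4)\<^sup>2"
    using assms by (auto simp: C_def D_def T_def add_pos_pos)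
  \<comment> \<open>The rate \<open>\<eta> / 4\<close> leaves a strict gap above
    \<open>1 - \<eta>\<close>, the limit of the cost of an arm in the last block.\<close>
  have lt: "1 - \<eta> < exp (- (\<eta> / 4))"
    using exp_ge_add_one_self[of "- (\<eta> / 4)"] assms by linarith
  note defs = early_len_def late_len_def block_len_def overhead_def
  have "eventually (\<lambda>N. 0 < real (early_len N)) at_top" unfolding defs by real_asymp
  moreover have "eventually (\<lambda>N. real (early_len N) < real (late_len N)) at_top" unfolding defs by real_asymp
  moreover have "eventually (\<lambda>N. real (late_len N) \<le> real N) at_top" unfolding defs by real_asymp
  moreover have "eventually (\<lambda>N. 0 < real (block_len N)) at_top" unfolding defs by real_asymp
  moreover have ln1: "eventually (\<lambda>N::nat. 1 < ln (real N)) at_top" by real_asymp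
  moreover have "(\<lambda>N::nat. 4 / (ln N + 2) * M) \<longlonglongrightarrow> 0" by real_asymp
  then have "eventually (\<lambda>N::nat. 4 / (ln N + 2) * M < z * s0) at_top" using zs by (intro order_tendstoD)
  moreover have "(\<lambda>N. exp (2 * (4 / (ln N + 2)) / s0 * M) * (1 + 1 / late_len N)) \<longlonglongrightarrow> 1"
    unfolding defs using M' \<open>0 < s0\<close> by real_asymp
  then have "eventually (\<lambda>N. exp (2 * (4 / (ln N + 2)) / s0 * M) * (1 + 1 / late_len N) < 1 + z) at_top"
    using assms by (intro order_tendstoD) auto
  moreover have "(\<lambda>N::nat. (4 / (ln N + 2))\<^sup>2 * M) \<longlonglongrightarrow> 0" by real_asymp
  then have "eventually (\<lambda>N::nat. (4 / (ln N + 2))\<^sup>2 * M < (z * s0\<^sup>2 / 4)\<^sup>2) at_top" using zs by (intro order_tendstoD)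
  moreover have "eventually (\<lambda>N::nat. (1 - z) * (ln N + 2) \<le> ln N) at_top" using assms by real_asymp
  moreover have "(\<lambda>N. ln N * (N * (exp (8 * M / (ln N)\<^sup>2 * late_len N - early_len N * D) + exp (- (T / (ln N)\<^sup>2 * late_len N))))) \<longlonglongrightarrow> 0"
    unfolding defs using M D T by real_asymp
  then have "eventually (\<lambda>N. ln N * (N * (exp (8 * M / (ln N)\<^sup>2 * late_len N - early_len N * D) + exp (- (T / (ln N)\<^sup>2 * late_len N)))) < 1) at_top"
    by (intro order_tendstoD) auto
  moreover have "(\<lambda>N. exp (8 / (ln N)\<^sup>2 * early_len N) * (1 - \<eta> + exp (- (early_len N * D))) + 1 / ln N) \<longlonglongrightarrow> 1 - \<eta>"
    unfolding defs using D assms(1,2) by real_asymp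
  then have "eventually (\<lambda>N. exp (8 / (ln N)\<^sup>2 * early_len N) * (1 - \<eta> + exp (- (early_len N * D))) + 1 / ln N < exp (- (\<eta> / 4))) at_top"
    using lt by (intro order_tendstoD)
  moreover have "(\<lambda>N. (ln 2 + ln (C * block_len N) + C * block_len N * overhead N
      + ln (late_len N * exp (8 / (ln N)\<^sup>2 * late_len N) + N + 1)) / (N / (ln N)\<^sup>2)) \<longlonglongrightarrow> 0"
    unfolding defs using C by real_asymp
  then have "eventually (\<lambda>N. (ln 2 + ln (C * block_len N) + C * block_len N * overhead N
      + ln (late_len N * exp (8 / (ln N)\<^sup>2 * late_len N) + N + 1)) / (N / (ln N)\<^sup>2) < z * (1 - z) ^ 10 * (2 * \<epsilon>\<^sup>2)) at_top"
    using T' by (intro order_tendstoD)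
  moreover have "filterlim (\<lambda>N. (\<eta> / 4 * block_len N - ln 2 - C * block_len N * overhead N) / (N / (ln N)\<^sup>2)) at_top at_top"
    unfolding defs using C assms(1) by real_asymp
  then have "eventually (\<lambda>N. 8 \<le> (\<eta> / 4 * block_len N - ln 2 - C * block_len N * overhead N) / (N / (ln N)\<^sup>2)) at_top"
    by (simp add: filterlim_at_top)
  ultimately show ?thesis
  proof eventually_elim
    case (elim N)
    then have "1 < ln N" by simp
    have pos: "0 < N / (ln N)\<^sup>2" using elim(3) elim(2) \<open>1 < ln N\<close> by (intro divide_pos_pos) auto
    have e10: "N * (exp (8 / (ln N)\<^sup>2 * (M * late_len N) - early_len N * D) + exp (- (T / (ln N)\<^sup>2 * late_len N))) \<le> 1 / ln N"
      using elim(10) \<open>1 < ln N\<close> by (simp add: pos_le_divide_eq mult_ac)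
    have e12: "ln 2 + ln (C * block_len N) + C * block_len N * overhead N
        + ln (late_len N * exp (8 / (ln N)\<^sup>2 * late_len N) + N + 1) \<le> z * (1 - z) ^ 10 * (2 * \<epsilon>\<^sup>2) * (N / (ln N)\<^sup>2)"
      using elim(12) pos by (simp only: pos_divide_less_eq less_imp_le)
    have e13: "8 * (N / (ln N)\<^sup>2) \<le> \<eta> / 4 * block_len N - ln 2 - C * block_len N * overhead N"
      using elim(13) pos by (simp only: pos_le_divide_eq)
    from elim e10 e12 e13 show ?case
      unfolding large_enough_def C_def D_def T_def by (simp only: of_nat_0_less_iff of_nat_less_iff of_nat_le_iff less_imp_le simp_thms times_divide_eq_right)
  qed
qed

section \<open>Error bound for one large sample size\<close>

lemma cab_ang: "cab a b = (ang a - ang b)\<^sup>2 / 2"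
  by (simp add: cab_def ang_def)

text \<open>Between the two levels of a block the mean is at least
  \<open>(1 - \<epsilon>) / 2\<close> and at most \<open>1 - 6 * d\<close>. The squared sine of the
  angle is four times the mean times its complement, hence the lower bound
  \<open>12 * (1 - \<epsilon>) * d\<close>. \<open>ang_close\<close> is a modulus of continuity
  because \<open>ang\<close> is not Lipschitz at the ends of the interval.\<close>

locale tuned =
  fixes \<eta> \<epsilon> z d :: real and M N :: nat
  assumes eta: "0 < \<eta>" "\<eta> < 1" and eps: "0 < \<epsilon>" "\<epsilon> < 1" and z: "0 < z" "z < 1" and M: "2 / z \<le> M"
    and d: "0 < d" "12 * d \<le> \<epsilon>"
    and ang_close: "\<And>u v. 0 \<le> u \<Longrightarrow> u \<le> v \<Longrightarrow> v \<le> 1 \<Longrightarrow> v - u \<le> 6 * d \<Longrightarrow> ang v - ang u \<le> z * (2 * \<epsilon>)"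
    and large: "large_enough \<eta> \<epsilon> z d (sqrt (12 * (1 - \<epsilon>) * d)) M N"
begin

abbreviation "s0 \<equiv> sqrt (12 * (1 - \<epsilon>) * d)"
abbreviation "l \<equiv> ln (real N)"

lemma s0_pos: "0 < s0" using eps d by simp

lemma N_pos: "0 < N" using large by (auto simp: large_enough_def)
lemma l_gt_1: "1 < l" using large by (simp add: large_enough_def)

lemma level_facts:
  assumes al: "(1 + \<epsilon>) / 2 \<le> \<alpha>" "\<alpha> \<le> 1 - 3 * d * g"
  shows "0 \<le> hi_level d g" "hi_level d g \<le> 1 - 6 * d" "(1 - \<epsilon>) / 2 \<le> lo_level d \<epsilon> g" "\<alpha> - \<epsilon> \<le> lo_level d \<epsilon> g"
    "lo_level d \<epsilon> g \<le> hi_level d g" "lo_level d \<epsilon> g \<le> 1"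
proof -
  define u where "u = 3 * d * g"
  have hi: "hi_level d g = 1 - u - 6 * d" and lo: "lo_level d \<epsilon> g = 1 - u - \<epsilon>"
    by (simp_all add: hi_level_def lo_level_def u_def algebra_simps)
  have "0 \<le> u" "\<alpha> \<le> 1 - u" "1 + \<epsilon> \<le> 2 * \<alpha>" using al d by (simp_all add: u_def)
  then show "0 \<le> hi_level d g" "hi_level d g \<le> 1 - 6 * d" "(1 - \<epsilon>) / 2 \<le> lo_level d \<epsilon> g" "\<alpha> - \<epsilon> \<le> lo_level d \<epsilon> g"
    "lo_level d \<epsilon> g \<le> hi_level d g" "lo_level d \<epsilon> g \<le> 1"
    using d eps by (simp_all add: hi lo field_simps)
qed

text \<open>By \<open>ang_gap_mono\<close> a guess above \<alpha> only enlarges the angular gap, so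
  the bound holds in every block up to the right one. Two of the factors \<open>1 - z\<close> pay
  for the \<open>6 * d\<close> lost between the levels, two for \<open>ln N + 2\<close> in place of
  \<open>ln N\<close>.\<close>

lemma slope_facts:
  assumes al: "(1 + \<epsilon>) / 2 \<le> \<alpha>" "\<alpha> \<le> 1 - 3 * d * g"
  shows "0 < slope d \<epsilon> N g" "slope d \<epsilon> N g \<le> 4 / (l + 2)"
    "(1 - z) ^ 4 * cab \<alpha> (\<alpha> - \<epsilon>) / l\<^sup>2 \<le> (slope d \<epsilon> N g)\<^sup>2 / 2"
proof -
  note lev = level_facts[OF al]
  define A where "A = 1 - 3 * d * real g"
  define D where "D = ang \<alpha> - ang (\<alpha> - \<epsilon>)"
  define x where "x = slope d \<epsilon> N g"
  define \<Delta> where "\<Delta> = ang (hi_level d g) - ang (lo_level d \<epsilon> g)"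
  have A1: "A \<le> 1" using d by (simp add: A_def)
  have hl: "hi_level d g = A - 6 * d" "lo_level d \<epsilon> g = A - \<epsilon>"
    by (simp_all add: A_def hi_level_def lo_level_def algebra_simps)
  have D2: "2 * \<epsilon> \<le> D" unfolding D_def using al eps A1 by (intro ang_gap_ge) (auto simp: A_def)
  have "D \<le> ang A - ang (A - \<epsilon>)"
    unfolding D_def using al eps A1 by (intro ang_gap_mono) (auto simp: A_def)
  moreover have "ang A - ang (hi_level d g) \<le> z * (2 * \<epsilon>)"
    using lev d A1 by (intro ang_close) (auto simp: hl)
  moreover have "z * (2 * \<epsilon>) \<le> z * D" using D2 z by (intro mult_left_mono) auto
  ultimately have Delta: "(1 - z) * D \<le> \<Delta>" by (simp add: \<Delta>_def hl algebra_simps)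
  have zD: "0 < (1 - z) * D" using D2 z eps by (intro mult_pos_pos) auto
  have pi4: "\<Delta> \<le> 4"
    using ang_bounds[of "hi_level d g"] ang_bounds[of "lo_level d \<epsilon> g"] lev d eps pi_less_4
    by (simp add: \<Delta>_def)
  have x: "x = \<Delta> / (l + 2)" by (simp add: x_def slope_def \<Delta>_def)
  have l2: "0 < l + 2" using l_gt_1 by simp
  show "0 < slope d \<epsilon> N g" using Delta zD l2 unfolding x_def[symmetric] x by (intro divide_pos_pos) auto
  show "slope d \<epsilon> N g \<le> 4 / (l + 2)" using pi4 l2 unfolding x_def[symmetric] x by (intro divide_right_mono) auto
  have "(1 - z) * (l + 2) \<le> l" using large by (simp add: large_enough_def)
  then have "(1 - z) / l \<le> 1 / (l + 2)" using l2 l_gt_1 by (simp add: field_simps)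
  then have "((1 - z) * D) * ((1 - z) / l) \<le> \<Delta> * (1 / (l + 2))"
    using Delta zD z l_gt_1 by (intro mult_mono) auto
  then have "((1 - z) * (1 - z) * (D / l))\<^sup>2 \<le> x\<^sup>2"
    using zD z l_gt_1 D2 eps unfolding x by (intro power_mono) (auto simp: mult_ac)
  moreover have "((1 - z) * (1 - z) * (D / l))\<^sup>2 = (1 - z) ^ 4 * D\<^sup>2 / l\<^sup>2"
    by (simp add: power_mult_distrib power_divide power4_eq_xxxx power2_eq_square)
  ultimately show "(1 - z) ^ 4 * cab \<alpha> (\<alpha> - \<epsilon>) / l\<^sup>2 \<le> (slope d \<epsilon> N g)\<^sup>2 / 2"
    by (simp add: cab_ang D_def[symmetric] x_def[symmetric])
qed

lemma arm_test_level:
  assumes al: "(1 + \<epsilon>) / 2 \<le> \<alpha>" "\<alpha> \<le> 1 - 3 * d * g"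
  shows "arm_test (hi_level d g) (ang (lo_level d \<epsilon> g)) (slope d \<epsilon> N g) d z s0 M (early_len N) (late_len N) N"
proof -
  note lev = level_facts[OF al] and sl = slope_facts[OF al]
  define x where "x = slope d \<epsilon> N g"
  have x: "0 < x" "x \<le> 4 / (l + 2)" using sl by (auto simp: x_def)
  note L = large[unfolded large_enough_def]
  show ?thesis unfolding x_def[symmetric]
  proof
    show "0 < d" "d \<le> 1" "0 < z" "z < 1" "0 < s0" "2 / z \<le> M"
      using d z s0_pos M eps by auto
    show "0 < early_len N" "early_len N < late_len N" "late_len N \<le> N" using L by auto
    show "0 < x" by fact
    have "x * M \<le> 4 / (l + 2) * M" using x by (intro mult_right_mono) auto
    then show "x * M \<le> z * s0" using L by linarith
    have "exp (2 * x / s0 * M) \<le> exp (2 * (4 / (l + 2)) / s0 * M)"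
      unfolding exp_le_cancel_iff using x s0_pos by (intro mult_right_mono divide_right_mono mult_left_mono) auto
    then have "exp (2 * x / s0 * M) * (1 + 1 / late_len N) \<le> exp (2 * (4 / (l + 2)) / s0 * M) * (1 + 1 / late_len N)"
      by (intro mult_right_mono) auto
    then show "exp (2 * x / s0 * M) * (1 + 1 / late_len N) \<le> 1 + z" using L by linarith
    have "x\<^sup>2 * M \<le> (4 / (l + 2))\<^sup>2 * M" using x by (intro mult_right_mono power_mono) auto
    then show "x\<^sup>2 * M \<le> (z * s0\<^sup>2 / 4)\<^sup>2" using L by linarith
    show "0 \<le> hi_level d g" "hi_level d g \<le> 1" using lev d by auto
    show "0 \<le> ang (lo_level d \<epsilon> g)" using lev eps ang_bounds by auto
    have "x * (1 + harm N) \<le> x * (l + 2)" using x harm_le_ln[OF N_pos] by (intro mult_left_mono) auto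
    also have "\<dots> = ang (hi_level d g) - ang (lo_level d \<epsilon> g)"
      using l_gt_1 by (simp add: x_def slope_def)
    finally show "ang (lo_level d \<epsilon> g) + x * (1 + harm N) \<le> ang (hi_level d g)" by simp
    fix t assume t: "ang (lo_level d \<epsilon> g) \<le> t" "t \<le> ang (hi_level d g)"
    have t0: "0 \<le> t" "t \<le> pi"
      using t ang_bounds[of "lo_level d \<epsilon> g"] ang_bounds[of "hi_level d g"] lev eps d by auto
    have "quality (ang (lo_level d \<epsilon> g)) \<le> quality t"
      using t t0 ang_bounds[of "lo_level d \<epsilon> g"] lev eps by (intro quality_mono) auto
    then have q1: "(1 - \<epsilon>) / 2 \<le> quality t" using lev eps by (simp add: quality_ang)
    have "quality t \<le> quality (ang (hi_level d g))"
      using t t0 ang_bounds[of "hi_level d g"] lev d by (intro quality_mono) auto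
    then have q2: "6 * d \<le> 1 - quality t" using lev d by (simp add: quality_ang)
    have "(1 - \<epsilon>) / 2 * (6 * d) \<le> quality t * (1 - quality t)"
      using q1 q2 eps d by (intro mult_mono) auto
    moreover have "(1 - \<epsilon>) / 2 * (6 * d) = 12 * (1 - \<epsilon>) * d / 4" by simp
    ultimately have "12 * (1 - \<epsilon>) * d \<le> (sin t)\<^sup>2" unfolding quality_variance by linarith
    then show "s0 \<le> sin t" using sin_ge_zero[OF t0] by (intro real_le_lsqrt) auto
  qed
qed

lemma cab_bounds:
  assumes al: "(1 + \<epsilon>) / 2 \<le> \<alpha>" "\<alpha> \<le> 1"
  shows "2 * \<epsilon>\<^sup>2 \<le> cab \<alpha> (\<alpha> - \<epsilon>)" "cab \<alpha> (\<alpha> - \<epsilon>) \<le> 8"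
proof -
  have D: "2 * \<epsilon> \<le> ang \<alpha> - ang (\<alpha> - \<epsilon>)" using al eps by (intro ang_gap_ge) auto
  then have "(2 * \<epsilon>)\<^sup>2 \<le> (ang \<alpha> - ang (\<alpha> - \<epsilon>))\<^sup>2" using eps by (intro power_mono) auto
  then show "2 * \<epsilon>\<^sup>2 \<le> cab \<alpha> (\<alpha> - \<epsilon>)" by (simp add: cab_ang)
  have "ang \<alpha> - ang (\<alpha> - \<epsilon>) \<le> 4"
    using ang_bounds[of \<alpha>] ang_bounds[of "\<alpha> - \<epsilon>"] al eps pi_less_4 by auto
  then have "(ang \<alpha> - ang (\<alpha> - \<epsilon>))\<^sup>2 \<le> 4\<^sup>2" using D eps by (intro power_mono) auto
  then show "cab \<alpha> (\<alpha> - \<epsilon>) \<le> 8" by (simp add: cab_ang)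
qed

text \<open>The eleven factors \<open>1 - z\<close>: four from the slope, five from the test of an
  arm, one for the margin \<tau> between \<open>lam\<close> and the crossing rate, one for
  prefactors and overhead.\<close>

lemma err_prob_le_exp:
  assumes r: "reservoir \<mu>" and al: "(1 + \<epsilon>) / 2 \<le> \<alpha>" "\<alpha> = Ginv \<mu> (1 - \<eta>)"
  shows "err_prob (sequential_alg (block_rule d \<epsilon> N)) N \<mu> (\<alpha> - \<epsilon>)
    \<le> exp (- ((1 - z) ^ 11 * cab \<alpha> (\<alpha> - \<epsilon>) * (N / l\<^sup>2)))"
proof -
  note L = large[unfolded large_enough_def]
  let ?m0 = "early_len N" let ?n0 = "late_len N" let ?K = "block_len N" let ?C = "1 / (3 * d) + 1"
  define c where "c = cab \<alpha> (\<alpha> - \<epsilon>)"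
  define lam where "lam = (1 - z) ^ 10 * c / l\<^sup>2"
  define \<tau> where "\<tau> = z * (1 - z) ^ 9 * (2 * \<epsilon>\<^sup>2) / l\<^sup>2"
  \<comment> \<open>\<open>g\<close> is the block whose interval contains \<alpha>, and
    \<open>J\<close> is the end of that block. Later blocks, whose thresholds may be too low, are
    entered only after all \<open>J\<close> arms have been dropped.\<close>
  define g where "g = nat \<lfloor>(1 - \<alpha>) / (3 * d)\<rfloor>"
  define J where "J = (g + 1) * ?K"
  define S where "S = ?n0 * exp (8 / l\<^sup>2 * ?n0) + N + 1"
  have a1: "\<alpha> \<le> 1" unfolding al(2) by (intro Ginv_facts r eta)
  have c: "2 * \<epsilon>\<^sup>2 \<le> c" "c \<le> 8" unfolding c_def using cab_bounds al(1) a1 by auto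
  have c0: "0 < c" using c(1) eps by (smt (verit) zero_less_power)
  have l2: "0 < l\<^sup>2" using l_gt_1 by simp
  have z1: "0 < 1 - z" using z by simp
  have lam0: "0 \<le> lam" using c0 z1 by (simp add: lam_def)
  have lam8: "lam \<le> 8 / l\<^sup>2"
  proof -
    have "(1 - z) ^ 10 * c \<le> 1 * 8" using c c0 z by (intro mult_mono power_le_one) auto
    then show ?thesis using l2 by (simp add: lam_def divide_right_mono)
  qed
  have tau0: "0 \<le> \<tau>" using z1 z by (simp add: \<tau>_def)
  have lamtau: "lam + \<tau> \<le> (1 - z) ^ 9 * c / l\<^sup>2"
  proof -
    have "z * (1 - z) ^ 9 * (2 * \<epsilon>\<^sup>2) \<le> z * (1 - z) ^ 9 * c" using z c by (intro mult_left_mono) auto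
    then have "(1 - z) ^ 10 * c + z * (1 - z) ^ 9 * (2 * \<epsilon>\<^sup>2) \<le> (1 - z) ^ 10 * c + z * (1 - z) ^ 9 * c" by simp
    also have "\<dots> = (1 - z) ^ 9 * c" by (simp add: power_Suc[of _ 9, simplified] algebra_simps)
    finally show ?thesis using l2 by (simp add: lam_def \<tau>_def divide_right_mono flip: add_divide_distrib)
  qed
  have gle: "real g \<le> (1 - \<alpha>) / (3 * d)" "(1 - \<alpha>) / (3 * d) < g + 1"
  proof -
    have "0 \<le> (1 - \<alpha>) / (3 * d)" using a1 d by simp
    then have "real g = of_int \<lfloor>(1 - \<alpha>) / (3 * d)\<rfloor>" by (simp add: g_def)
    then show "real g \<le> (1 - \<alpha>) / (3 * d)" "(1 - \<alpha>) / (3 * d) < g + 1"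
      using floor_correct[of "(1 - \<alpha>) / (3 * d)"] by linarith+
  qed
  have g1: "\<alpha> \<le> 1 - 3 * d * real i" if "i \<le> g" for i
  proof -
    have "real i \<le> (1 - \<alpha>) / (3 * d)" using gle that by linarith
    then show ?thesis using d by (simp add: pos_le_divide_eq algebra_simps)
  qed
  have g2: "hi_level d g + 3 * d \<le> \<alpha>"
    using gle(2) d by (simp add: pos_divide_less_eq hi_level_def algebra_simps)
  have K0: "0 < ?K" using L by simp
  have JC: "real J \<le> ?C * ?K"
  proof -
    have "(1 - \<alpha>) / (3 * d) \<le> 1 / (3 * d)" using al(1) eps d by (intro divide_right_mono) auto
    then have "real g \<le> 1 / (3 * d)" using gle(1) by linarith
    then show ?thesis unfolding J_def of_nat_mult by (intro mult_right_mono) auto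
  qed
  have divg: "i div ?K \<le> g" if "i < J" for i
    using that K0 by (simp add: J_def div_less_iff_less_mult less_Suc_eq_le[symmetric])
  have overhead0: "0 \<le> overhead N" using l_gt_1 by (simp add: overhead_def)
  let ?R = "block_rule d \<epsilon> N"
  have cost: "mean_cost \<mu> (\<lambda>_. stop_cost N lam (?R i)) \<le> ennreal (exp (8 / l\<^sup>2 * ?m0) * \<nu> + 1 / l)"
    if i: "i < J" and nu: "0 \<le> \<nu>" "(\<integral>\<^sup>+p. bern_prob p (stops_at (?R i) ?m0) \<partial>\<mu>) \<le> ennreal \<nu>" for i \<nu>
  proof -
    define h where "h = i div ?K"
    note h = g1[OF divg[OF i], folded h_def]
    interpret T: arm_test "hi_level d h" "ang (lo_level d \<epsilon> h)" "slope d \<epsilon> N h" d z s0 M ?m0 ?n0 N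
      using arm_test_level[OF al(1) h] .
    have R: "?R i = T.rejects" by (simp add: block_rule_def h_def Let_def)
    have "(1 - z) ^ 9 * c / l\<^sup>2 = ((1 - z) ^ 4 * c / l\<^sup>2) * (1 - z) ^ 5" by (simp add: power_add[symmetric])
    also have "\<dots> \<le> (slope d \<epsilon> N h)\<^sup>2 / 2 * (1 - z) ^ 5"
      using slope_facts(3)[OF al(1) h] z1 unfolding c_def by (intro mult_right_mono) auto
    finally have "lam + \<tau> \<le> (slope d \<epsilon> N h)\<^sup>2 / 2 * (1 - z) ^ 5" using lamtau by linarith
    then have "mean_cost \<mu> (\<lambda>_. stop_cost N lam (?R i))
        \<le> ennreal (exp (lam * ?m0) * \<nu> + N * (exp (lam * (M * ?n0) - ?m0 * d\<^sup>2 / 2) + exp (- (\<tau> * ?n0))))"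
      using nu lam0 tau0 unfolding R by (intro T.mean_stop_cost_le r)
    also have "\<dots> \<le> ennreal (exp (8 / l\<^sup>2 * ?m0) * \<nu> + N * (exp (8 / l\<^sup>2 * (M * ?n0) - ?m0 * d\<^sup>2 / 2) + exp (- (\<tau> * ?n0))))"
      using nu mult_right_mono[OF lam8, of "real ?m0"] mult_right_mono[OF lam8, of "real (M * ?n0)"]
      by (intro ennreal_leI add_mono mult_right_mono mult_left_mono) auto
    also have "\<dots> \<le> ennreal (exp (8 / l\<^sup>2 * ?m0) * \<nu> + 1 / l)"
      using L unfolding \<tau>_def by (intro ennreal_leI add_left_mono) linarith
    finally show ?thesis .
  qed
  have "err_prob (sequential_alg ?R) N \<mu> (\<alpha> - \<epsilon>)
      \<le> J * (exp (- lam * N) * (exp (overhead N * J) * S)) + exp (overhead N * J - \<eta> / 4 * ?K)"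
  proof (rule err_prob_le[OF r lam0 overhead0])
    show "0 \<le> S" by (simp add: S_def)
    show "?K \<le> J" by (simp add: J_def)
    fix i assume i: "i < J"
    have "(\<integral>\<^sup>+p. bern_prob p (stops_at (?R i) ?m0) \<partial>\<mu>) \<le> ennreal 1"
      using bern_prob_le_1 by (intro reservoir_nn_integral_le[OF r]) simp
    then have "mean_cost \<mu> (\<lambda>_. stop_cost N lam (?R i)) \<le> ennreal (exp (8 / l\<^sup>2 * ?m0) * 1 + 1 / l)"
      by (intro cost i) auto
    also have "\<dots> \<le> ennreal (exp (overhead N))"
    proof (intro ennreal_leI)
      have "exp u + v \<le> exp (u + v)" if "0 \<le> u" "0 \<le> v" for u v :: real
      proof -
        have "exp u * (1 + v) \<le> exp u * exp v" by (intro mult_left_mono exp_ge_add_one_self) auto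
        moreover have "1 * v \<le> exp u * v" using that by (intro mult_right_mono) auto
        ultimately show ?thesis by (simp add: exp_add algebra_simps)
      qed
      from this[of "8 / l\<^sup>2 * ?m0" "1 / l"] show "exp (8 / l\<^sup>2 * ?m0) * 1 + 1 / l \<le> exp (overhead N)"
        using l_gt_1 by (simp add: overhead_def)
    qed
    finally show "mean_cost \<mu> (\<lambda>_. stop_cost N lam (?R i)) \<le> ennreal (exp (overhead N))" .
    define h where "h = i div ?K"
    note h = g1[OF divg[OF i], folded h_def]
    interpret T: arm_test "hi_level d h" "ang (lo_level d \<epsilon> h)" "slope d \<epsilon> N h" d z s0 M ?m0 ?n0 N
      using arm_test_level[OF al(1) h] .
    have R: "?R i = T.rejects" by (simp add: block_rule_def h_def Let_def)
    have "(1 - z) ^ 9 * c / l\<^sup>2 = ((1 - z) ^ 4 * c / l\<^sup>2) * (1 - z) ^ 5" by (simp add: power_add[symmetric])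
    also have "\<dots> \<le> (slope d \<epsilon> N h)\<^sup>2 / 2 * (1 - z) ^ 5"
      using slope_facts(3)[OF al(1) h] z1 unfolding c_def by (intro mult_right_mono) auto
    finally have "lam \<le> (slope d \<epsilon> N h)\<^sup>2 / 2 * (1 - z) ^ 5" using lamtau tau0 by linarith
    moreover have "\<alpha> - \<epsilon> \<le> quality (ang (lo_level d \<epsilon> h))"
      using level_facts[OF al(1) h] eps by (simp add: quality_ang)
    ultimately have "mean_cost \<mu> (\<lambda>p X. survival_cost N lam (?R i) X * of_bool (p < \<alpha> - \<epsilon>))
        \<le> ennreal (?n0 * exp (lam * ?n0) + N + 1)"
      using lam0 unfolding R by (intro T.mean_survival_cost_le r)
    also have "\<dots> \<le> ennreal S"
      unfolding S_def using mult_right_mono[OF lam8, of "real ?n0"]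
      by (intro ennreal_leI add_mono mult_left_mono) auto
    finally show "mean_cost \<mu> (\<lambda>p X. survival_cost N lam (?R i) X * of_bool (p < \<alpha> - \<epsilon>)) \<le> ennreal S" .
    assume "J - ?K \<le> i"
    then have "g \<le> h" unfolding h_def J_def using K0 by (simp add: less_eq_div_iff_mult_less_eq)
    then have hg: "h = g" using divg[OF i] by (simp add: h_def)
    have "(\<integral>\<^sup>+p. bern_prob p (stops_at (?R i) ?m0) \<partial>\<mu>) \<le> ennreal (1 - \<eta> + exp (- (?m0 * d\<^sup>2 / 2)))"
      unfolding R using g2 al(2) hg by (intro T.stop_integral_good r eta) auto
    then have "mean_cost \<mu> (\<lambda>_. stop_cost N lam (?R i))
        \<le> ennreal (exp (8 / l\<^sup>2 * ?m0) * (1 - \<eta> + exp (- (?m0 * d\<^sup>2 / 2))) + 1 / l)"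
      using eta by (intro cost i) (auto intro!: add_nonneg_nonneg)
    also have "\<dots> \<le> ennreal (exp (- (\<eta> / 4)))" using L by (intro ennreal_leI) linarith
    finally show "mean_cost \<mu> (\<lambda>_. stop_cost N lam (?R i)) \<le> ennreal (exp (- (\<eta> / 4)))" .
  qed
  also have "\<dots> \<le> exp (- ((1 - z) ^ 11 * c * (N / l\<^sup>2))) / 2 + exp (- ((1 - z) ^ 11 * c * (N / l\<^sup>2))) / 2"
  proof (intro add_mono)
    let ?X = "(1 - z) ^ 11 * c * (N / l\<^sup>2)"
    have S0: "0 < S" by (simp add: S_def add_nonneg_pos)
    have CK: "0 < ?C * ?K" using K0 d by (intro mult_pos_pos add_pos_pos) auto
    have OJ: "overhead N * J \<le> ?C * ?K * overhead N"
      using mult_left_mono[OF JC overhead0] by (simp add: mult_ac)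
    have Nl: "0 \<le> N / l\<^sup>2" by simp
    have "z * (1 - z) ^ 10 * (2 * \<epsilon>\<^sup>2) * (N / l\<^sup>2) \<le> z * (1 - z) ^ 10 * c * (N / l\<^sup>2)"
      using z c Nl by (intro mult_right_mono mult_left_mono) auto
    moreover have "lam * N = ?X + z * (1 - z) ^ 10 * c * (N / l\<^sup>2)"
    proof -
      have eq: "(1 - z) ^ 10 = (1 - z) ^ 11 + z * (1 - z) ^ 10" by (simp add: power_Suc[of _ 10, simplified] algebra_simps)
      have "lam * N = (1 - z) ^ 10 * (c * (N / l\<^sup>2))" by (simp add: lam_def)
      also have "\<dots> = ((1 - z) ^ 11 + z * (1 - z) ^ 10) * (c * (N / l\<^sup>2))"
        by (rule arg_cong[OF eq, of "\<lambda>v. v * (c * (N / l\<^sup>2))"])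
      finally show ?thesis by (simp only: distrib_right mult.assoc)
    qed
    moreover have "ln 2 + ln (?C * ?K) + ?C * ?K * overhead N + ln S \<le> z * (1 - z) ^ 10 * (2 * \<epsilon>\<^sup>2) * (N / l\<^sup>2)"
      using L unfolding S_def by linarith
    ultimately have e: "ln (?C * ?K) + (- lam * N + overhead N * J + ln S) \<le> - ?X - ln 2"
      using OJ by simp
    have "J * (exp (- lam * N) * (exp (overhead N * J) * S))
        \<le> (?C * ?K) * (exp (- lam * N) * (exp (overhead N * J) * S))"
      using JC S0 by (intro mult_right_mono) auto
    also have "\<dots> = exp (ln (?C * ?K) + (- lam * N + overhead N * J + ln S))"
      by (simp only: exp_add exp_ln[OF CK] exp_ln[OF S0] mult.assoc)
    also have "\<dots> \<le> exp (- ?X - ln 2)" using e by simp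
    also have "\<dots> = exp (- ?X) / 2" by (simp add: exp_diff)
    finally show "J * (exp (- lam * N) * (exp (overhead N * J) * S)) \<le> exp (- ?X) / 2" .
    have "(1 - z) ^ 11 * c \<le> 1 * 8" using c c0 z by (intro mult_mono power_le_one) auto
    then have "?X \<le> 8 * (N / l\<^sup>2)" using Nl by (intro mult_right_mono) auto
    moreover have "8 * (N / l\<^sup>2) \<le> \<eta> / 4 * ?K - ln 2 - ?C * ?K * overhead N" using L by linarith
    ultimately have "overhead N * J - \<eta> / 4 * ?K \<le> - ?X - ln 2" using OJ by linarith
    then have "exp (overhead N * J - \<eta> / 4 * ?K) \<le> exp (- ?X - ln 2)" by simp
    also have "\<dots> = exp (- ?X) / 2" by (simp add: exp_diff)
    finally show "exp (overhead N * J - \<eta> / 4 * ?K) \<le> exp (- ?X) / 2" .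
  qed
  finally show ?thesis by (simp add: c_def)
qed

lemma rate_ge:
  assumes r: "reservoir \<mu>" and al: "(1 + \<epsilon>) / 2 \<le> Ginv \<mu> (1 - \<eta>)"
  shows "ereal ((1 - z) ^ 11) \<le> rate (sequential_alg (block_rule d \<epsilon> N)) N \<mu> \<eta> \<epsilon>"
proof -
  define \<alpha> where "\<alpha> = Ginv \<mu> (1 - \<eta>)"
  define P where "P = err_prob (sequential_alg (block_rule d \<epsilon> N)) N \<mu> (\<alpha> - \<epsilon>)"
  define c where "c = cab \<alpha> (\<alpha> - \<epsilon>)"
  have a1: "\<alpha> \<le> 1" unfolding \<alpha>_def by (intro Ginv_facts r eta)
  have "2 * \<epsilon>\<^sup>2 \<le> c" unfolding c_def using al a1 by (intro cab_bounds) (auto simp: \<alpha>_def)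
  then have c0: "0 < c" using eps by (smt (verit) zero_less_power)
  have P: "P \<le> exp (- ((1 - z) ^ 11 * c * (N / l\<^sup>2)))"
    unfolding P_def c_def using r al by (intro err_prob_le_exp) (auto simp: \<alpha>_def)
  have rate: "rate (sequential_alg (block_rule d \<epsilon> N)) N \<mu> \<eta> \<epsilon> =
      (if P = 0 then \<infinity> else ereal ((- ln P) * l\<^sup>2 / (c * N)))"
    by (simp add: rate_def Let_def P_def c_def \<alpha>_def)
  show ?thesis
  proof (cases "P = 0")
    case False
    then have "0 < P" by (simp add: P_def err_prob_def order.not_eq_order_implies_strict)
    then have "ln P \<le> ln (exp (- ((1 - z) ^ 11 * c * (N / l\<^sup>2))))" using P by (subst ln_le_cancel_iff) auto
    then have "(1 - z) ^ 11 * (c * N / l\<^sup>2) \<le> - ln P" by simp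
    then have "(1 - z) ^ 11 * (c * N / l\<^sup>2) * (l\<^sup>2 / (c * N)) \<le> - ln P * (l\<^sup>2 / (c * N))"
      using c0 by (intro mult_right_mono) auto
    moreover have "(1 - z) ^ 11 * (c * N / l\<^sup>2) * (l\<^sup>2 / (c * N)) = (1 - z) ^ 11"
    proof -
      have "u * (c * n / q) * (q / (c * n)) = u" if "0 < n" "0 < q" for u n q
        using that c0 by simp
      moreover have "0 < l\<^sup>2" using l_gt_1 by (intro zero_less_power) linarith
      ultimately show ?thesis using N_pos by (metis of_nat_0_less_iff)
    qed
    ultimately show ?thesis using False by (simp add: rate)
  qed (simp add: rate)
qed

end

section \<open>Letting the loss tend to zero\<close>

lemma eventually_good_alg:
  fixes \<eta> \<epsilon> \<kappa> :: real
  assumes eta: "0 < \<eta>" "\<eta> < 1" and eps: "0 < \<epsilon>" "\<epsilon> < 1" and \<kappa>: "0 < \<kappa>" "\<kappa> < 1"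
  shows "eventually (\<lambda>N. \<exists>A. alg_measurable A \<and> (\<forall>\<mu>. reservoir \<mu> \<longrightarrow> (1 + \<epsilon>) / 2 \<le> Ginv \<mu> (1 - \<eta>)
    \<longrightarrow> ereal (1 - \<kappa>) \<le> rate A N \<mu> \<eta> \<epsilon>)) at_top"
proof -
  \<comment> \<open>Bernoulli's inequality turns the eleven factors \<open>1 - z\<close> into a
    total loss of at most \<kappa>.\<close>
  define z where "z = \<kappa> / 11"
  define M where "M = nat \<lceil>2 / z\<rceil>"
  have z: "0 < z" "z < 1" using \<kappa> by (auto simp: z_def)
  have M: "2 / z \<le> M" unfolding M_def by (rule real_nat_ceiling_ge)
  have "0 < 2 / z" using z by simp
  then have M0: "0 < M" using M by (cases "M = 0") auto
  have "uniformly_continuous_on {0..1} ang"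
    unfolding ang_def by (intro compact_uniformly_continuous continuous_intros) auto
  moreover have "0 < z * (2 * \<epsilon>)" using z eps by simp
  ultimately obtain \<delta> where \<delta>: "0 < \<delta>"
    "\<And>u v. u \<in> {0..1} \<Longrightarrow> v \<in> {0..1} \<Longrightarrow> dist v u < \<delta> \<Longrightarrow> dist (ang v) (ang u) < z * (2 * \<epsilon>)"
    unfolding uniformly_continuous_on_def by metis
  define d where "d = min (\<epsilon> / 12) (\<delta> / 12)"
  have d: "0 < d" "12 * d \<le> \<epsilon>" "6 * d < \<delta>" using eps \<delta>(1) by (auto simp: d_def)
  have close: "ang v - ang u \<le> z * (2 * \<epsilon>)" if "0 \<le> u" "u \<le> v" "v \<le> 1" "v - u \<le> 6 * d" for u v
    using \<delta>(2)[of u v] that d by (auto simp: dist_real_def)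
  have "0 < sqrt (12 * (1 - \<epsilon>) * d)" using eps d by simp
  with eta eps z d M0 have "eventually (large_enough \<eta> \<epsilon> z d (sqrt (12 * (1 - \<epsilon>) * d)) M) at_top"
    by (intro eventually_large_enough)
  then show ?thesis
  proof eventually_elim
    case (elim N)
    interpret tuned \<eta> \<epsilon> z d M N
      using eta eps z M d close elim by unfold_locales auto
    have "1 - \<kappa> \<le> (1 - z) ^ 11" using Bernoulli_inequality[of "- z" 11] z by (simp add: z_def)
    then show ?case
      using rate_ge alg_measurable_sequential order_trans[of "ereal (1 - \<kappa>)" "ereal ((1 - z) ^ 11)"]
      by (intro exI[of _ "sequential_alg (block_rule d \<epsilon> N)"]) auto
  qed
qed

theorem theorem1p10:
  fixes \<eta> \<epsilon> :: real
  assumes "0 < \<eta>" "\<eta> < 1" "0 < \<epsilon>" "\<epsilon> < 1"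
  shows "\<exists>A :: nat \<Rightarrow> alg. (\<forall>N. alg_measurable (A N)) \<and>
           (\<forall>\<mu> :: nat \<Rightarrow> real measure.
              (\<forall>N\<ge>1. reservoir (\<mu> N) \<and> Ginv (\<mu> N) (1 - \<eta>) \<ge> (1 + \<epsilon>) / 2) \<longrightarrow>
              limsup (\<lambda>N. rate (A N) N (\<mu> N) \<eta> \<epsilon>) \<ge> 1)"
proof -
  \<comment> \<open>The algorithms found so far depend on the loss \<kappa>, but one sequence must
    serve all losses. \<open>good\<close> quantifies over all reservoirs, so the choice made with it
    never looks at \<mu>.\<close>
  define good where "good A N k \<longleftrightarrow> (\<forall>\<mu>. reservoir \<mu> \<longrightarrow> (1 + \<epsilon>) / 2 \<le> Ginv \<mu> (1 - \<eta>)
    \<longrightarrow> ereal (1 - 1 / real (k + 2)) \<le> rate A N \<mu> \<eta> \<epsilon>)" for A N k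
  have anti: "good A N k" if "good A N k'" "k \<le> k'" for A N k k'
  proof -
    have "1 / real (k' + 2) \<le> 1 / real (k + 2)" using that by (intro frac_le) auto
    then have "ereal (1 - 1 / real (k + 2)) \<le> ereal (1 - 1 / real (k' + 2))" by simp
    then show ?thesis using that(1) unfolding good_def by (blast intro: order_trans)
  qed
  \<comment> \<open>Diagonal choice: for each \<open>N\<close> take an algorithm that is good for
    the largest attainable \<open>k \<le> N\<close>. By \<open>anti\<close> it is good for all
    smaller \<open>k\<close>, so every fixed \<open>k\<close> is served from some \<open>N\<close>
    on; the bound \<open>k \<le> N\<close> makes the maximum exist.\<close>
  have "\<exists>A. alg_measurable A \<and> (\<forall>k\<le>N. (\<exists>A'. alg_measurable A' \<and> good A' N k) \<longrightarrow> good A N k)" for N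
  proof (cases "\<exists>k\<le>N. \<exists>A'. alg_measurable A' \<and> good A' N k")
    case True
    let ?Q = "{k. k \<le> N \<and> (\<exists>A'. alg_measurable A' \<and> good A' N k)}"
    have fin: "finite ?Q" by simp
    have "Max ?Q \<in> ?Q" using True by (intro Max_in fin) auto
    then obtain A where "alg_measurable A" "good A N (Max ?Q)" by auto
    moreover have "k \<le> Max ?Q" if "k \<in> ?Q" for k using that fin by simp
    ultimately show ?thesis using anti by blast
  next
    case False
    then show ?thesis using alg_measurable_sequential by blast
  qed
  then obtain A where A: "\<And>N. alg_measurable (A N)"
    "\<And>N k. k \<le> N \<Longrightarrow> \<exists>A'. alg_measurable A' \<and> good A' N k \<Longrightarrow> good (A N) N k"
    by metis
  have "1 \<le> limsup (\<lambda>N. rate (A N) N (\<mu> N) \<eta> \<epsilon>)"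
    if \<mu>: "\<forall>N\<ge>1. reservoir (\<mu> N) \<and> Ginv (\<mu> N) (1 - \<eta>) \<ge> (1 + \<epsilon>) / 2" for \<mu>
  proof (rule LIMSEQ_le_const2)
    show "(\<lambda>k. ereal (1 - 1 / real (k + 2))) \<longlonglongrightarrow> 1"
      unfolding one_ereal_def by (intro tendsto_ereal) real_asymp
    have "ereal (1 - 1 / real (k + 2)) \<le> limsup (\<lambda>N. rate (A N) N (\<mu> N) \<eta> \<epsilon>)" for k
    proof (rule le_Limsup)
      have "eventually (\<lambda>N. \<exists>A'. alg_measurable A' \<and> good A' N k) at_top"
        unfolding good_def using assms by (intro eventually_good_alg) auto
      moreover have "eventually (\<lambda>N. max 1 k \<le> N) at_top" by (rule eventually_ge_at_top)
      ultimately show "eventually (\<lambda>N. ereal (1 - 1 / real (k + 2)) \<le> rate (A N) N (\<mu> N) \<eta> \<epsilon>) at_top"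
      proof eventually_elim
        case (elim N)
        then have "good (A N) N k" by (intro A(2)) auto
        then show ?case using \<mu> elim unfolding good_def by simp
      qed
    qed simp
    then show "\<exists>K. \<forall>k\<ge>K. ereal (1 - 1 / real (k + 2)) \<le> limsup (\<lambda>N. rate (A N) N (\<mu> N) \<eta> \<epsilon>)" by blast
  qed
  with A(1) show ?thesis by blast
qed

end
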